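(* Let $[K]$ be a nontrivial knot type. Then $s_{CL}[K] \geq 6\,b[K]$, where $s_{CL}[K]$ is the cubic lattice stick index of $[K]$ and $b[K]$ is its bridge index.
   Context: The cubic lattice is the subset $(\mathbb{R}\times\mathbb{Z}\times\mathbb{Z})\cup(\mathbb{Z}\times\mathbb{R}\times\mathbb{Z})\cup(\mathbb{Z}\times\mathbb{Z}\times\mathbb{R})$ of $\mathbb{R}^3$. A lattice stick conformation is a polygonal knot $K$ contained in the cubic lattice (with vertices at points of $\mathbb{Z}^3$); $[K]$ denotes its knot type (the collection of all conformations of the knot type). A stick of $K$ is a maximal line segment contained in $K$ (of any length). $s_{CL}(K)$ is the number of sticks of $K$, and the cubic lattice stick index $s_{CL}[K]$ is the minimum of $s_{CL}(K')$ over all lattice stick conformations $K'$ of the knot type $[K]$. The bridge index is $b[K]=\min_{K\in[K]}\min_{\mathbf v\in S^2}(\text{number of local maxima of } K \text{ when projected to the direction } \mathbf v)$. *)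

theory Defs
  imports "HOL-Analysis.Analysis" "HOL-Library.Extended_Nat"
begin

text \<open>Vertices are listed cyclically: edge \<open>i\<close> joins vertex \<open>i\<close> to vertex \<open>i + 1\<close> modulo the length.\<close>

definition polygon_edge :: "(real^3) list \<Rightarrow> nat \<Rightarrow> (real^3) set" where
  "polygon_edge vs i = closed_segment (vs ! i) (vs ! (Suc i mod length vs))"

definition polygon_image :: "(real^3) list \<Rightarrow> (real^3) set" where
  "polygon_image vs = (\<Union>i<length vs. polygon_edge vs i)"

text \<open>Two different edges meet exactly in the vertices they share; consecutive edges may be
  collinear, so a vertex need not be a corner.\<close>

definition simple_closed_polygon :: "(real^3) list \<Rightarrow> bool" where
  "simple_closed_polygon vs \<longleftrightarrow>
     3 \<le> length vs \<and> distinct vs \<and>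
     (\<forall>i<length vs. \<forall>j<length vs. i \<noteq> j \<longrightarrow>
        polygon_edge vs i \<inter> polygon_edge vs j =
        {vs ! i, vs ! (Suc i mod length vs)} \<inter> {vs ! j, vs ! (Suc j mod length vs)})"

definition polygonal_knot :: "(real^3) set \<Rightarrow> bool" where
  "polygonal_knot K \<longleftrightarrow> (\<exists>vs. simple_closed_polygon vs \<and> K = polygon_image vs)"

text \<open>Ambient isotopy of \<open>\<real>\<^sup>3\<close>: a homotopy from the identity all of whose stages are homeomorphisms
  of the whole space. Knots are unoriented; mirror images are not identified.\<close>

definition ambient_isotopic :: "(real^3) set \<Rightarrow> (real^3) set \<Rightarrow> bool" where
  "ambient_isotopic K K' \<longleftrightarrow>
     (\<exists>f. homotopic_with_canon (\<lambda>h. \<exists>k. homeomorphism UNIV UNIV h k) UNIV UNIV id f \<and> f ` K = K')"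

definition knot_type :: "(real^3) set \<Rightarrow> (real^3) set set" where
  "knot_type K = {K'. polygonal_knot K' \<and> ambient_isotopic K K'}"

definition unknot :: "(real^3) set" where
  "unknot = {x. norm x = 1 \<and> x $ 3 = 0}"

definition trivial_knot :: "(real^3) set \<Rightarrow> bool" where
  "trivial_knot K \<longleftrightarrow> ambient_isotopic K unknot"

definition cubic_lattice :: "(real^3) set" where
  "cubic_lattice = {x. x $ 2 \<in> \<int> \<and> x $ 3 \<in> \<int>} \<union> {x. x $ 1 \<in> \<int> \<and> x $ 3 \<in> \<int>} \<union> {x. x $ 1 \<in> \<int> \<and> x $ 2 \<in> \<int>}"

definition lattice_conformation :: "(real^3) set \<Rightarrow> bool" where
  "lattice_conformation K \<longleftrightarrow>
     (\<exists>vs. simple_closed_polygon vs \<and> K = polygon_image vs \<and>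
           (\<forall>v\<in>set vs. \<forall>i. v $ i \<in> \<int>) \<and> K \<subseteq> cubic_lattice)"

definition line_segment_in :: "(real^3) set \<Rightarrow> (real^3) set \<Rightarrow> bool" where
  "line_segment_in K S \<longleftrightarrow> S \<subseteq> K \<and> (\<exists>a b. a \<noteq> b \<and> S = closed_segment a b)"

definition sticks :: "(real^3) set \<Rightarrow> (real^3) set set" where
  "sticks K = {S. line_segment_in K S \<and> (\<forall>S'. line_segment_in K S' \<and> S \<subseteq> S' \<longrightarrow> S' = S)}"

text \<open>Every knot type has a lattice conformation, so this is a minimum. It is taken in \<^typ>\<open>enat\<close>
  because the infimum of the empty set of naturals would be the junk value \<open>0\<close>.\<close>

definition cubic_lattice_stick_index :: "(real^3) set set \<Rightarrow> enat" where
  "cubic_lattice_stick_index T = (INF L\<in>{L\<in>T. lattice_conformation L}. enat (card (sticks L)))"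

text \<open>A polygonal knot may have flat pieces orthogonal to \<open>v\<close> (a lattice knot always does in a
  coordinate direction). A local maximum is therefore a connected component of a level set of the
  height function on \<open>K\<close> such that no point of \<open>K\<close> close to that component is higher: a flat piece
  counts once if \<open>K\<close> descends from both of its ends, and does not count otherwise (except that all
  of \<open>K\<close> is one local maximum if the height is constant on \<open>K\<close>). If no edge is orthogonal to
  \<open>v\<close>, these are the singletons of the local maximum points.\<close>

definition local_maxima :: "real^3 \<Rightarrow> (real^3) set \<Rightarrow> (real^3) set set" where
  "local_maxima v K =
     {C. \<exists>c. C \<in> components {x\<in>K. v \<bullet> x = c} \<and>
             (\<exists>U. open U \<and> C \<subseteq> U \<and> (\<forall>y\<in>K \<inter> U. v \<bullet> y \<le> c))}"

definition bridge_index :: "(real^3) set set \<Rightarrow> nat" where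
  "bridge_index T = (INF K\<in>T. INF v\<in>sphere 0 1. card (local_maxima v K))"

end

theory Submission
  imports Defs
begin

text \<open>Fix a direction \<open>v\<close> in which a polygon \<open>L\<close> is not flat. Leaving a local maximum along \<open>L\<close> in
  both directions, one descends along two different sticks whose tops lie in that local maximum; as a
  stick has only one top, \<open>L\<close> has at least twice as many sticks that are not orthogonal to \<open>v\<close> as it has
  local maxima. The sticks of a lattice conformation are parallel to the axes, so summing over the
  three axes gives \<open>6 b\<close>. If \<open>L\<close> lies in a coordinate plane, then \<open>b \<le> 1\<close>, and six sticks suffice. Both
  directions of the plane contain at least two sticks, and if one of them contains exactly two, then
  \<open>L\<close> is a rectangle, which is trivial.\<close>

subsection \<open>Ambient isotopies\<close>

text \<open>The case of a coordinate plane is separate because the count fails there: in the normal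
  direction a planar polygon is one single local maximum, but no stick rises or falls. The same
  direction bounds the bridge index by 1, so it remains to find six sticks inside the plane. A
  highest local maximum gives only two sticks per direction, one short of the three that are wanted;
  a rectangle attains this bound, so nontriviality has to enter here, through explicit isotopies
  that unknot rectangles. A lattice polygon has flat pieces in every coordinate direction. A local
  maximum can therefore contain many edges, and one has to walk along them to reach the descents.
  Sticks are maximal segments and may consist of several edges, so incidences are settled for edges
  and then transferred to sticks.\<close>

lemma homeomorphism_UNIV_I:
  fixes f :: "real^3 \<Rightarrow> real^3"
  assumes "continuous_on UNIV f" "inj f" "surj f"
  shows "\<exists>k. homeomorphism UNIV UNIV f k"
  using invariance_of_domain_homeomorphism[of UNIV f] assms open_UNIV order_refl by metis

text \<open>Reduces isotopies to algebra: the straight-line homotopy from the identity to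
  \<open>f\<close> is jointly continuous, and by invariance of domain a continuous bijective stage
  is a homeomorphism.\<close>

lemma ambient_isotopic_straight_line:
  fixes f :: "real^3 \<Rightarrow> real^3"
  assumes f: "continuous_on UNIV f"
    and inj: "\<And>t. t \<in> {0..1} \<Longrightarrow> inj (\<lambda>x. (1 - t) *\<^sub>R x + t *\<^sub>R f x)"
    and surj: "\<And>t. t \<in> {0..1} \<Longrightarrow> surj (\<lambda>x. (1 - t) *\<^sub>R x + t *\<^sub>R f x)"
  shows "ambient_isotopic K (f ` K)"
proof -
  define H where "H = (\<lambda>p. (1 - fst p) *\<^sub>R snd p + fst p *\<^sub>R f (snd p))"
  have "continuous_on ({0..1} \<times> UNIV) H"
    unfolding H_def
    by (intro continuous_intros continuous_on_compose2[OF f]) auto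
  moreover have "\<exists>k. homeomorphism UNIV UNIV (\<lambda>x. H (t, x)) k" if "t \<in> {0..1}" for t
    using inj[OF that] surj[OF that]
    by (intro homeomorphism_UNIV_I) (auto simp: H_def intro!: continuous_intros f)
  ultimately have "homotopic_with_canon (\<lambda>h. \<exists>k. homeomorphism UNIV UNIV h k) UNIV UNIV id f"
    unfolding homotopic_with_def
    by (intro exI[of _ H]) (auto simp: prod_topology_subtopology_eu H_def simp del: subtopology_UNIV)
  then show ?thesis
    unfolding ambient_isotopic_def by blast
qed

lemma ambient_isotopic_trans [trans]:
  assumes "ambient_isotopic K L" "ambient_isotopic L M"
  shows "ambient_isotopic K M"
proof -
  let ?P = "\<lambda>h :: real^3 \<Rightarrow> real^3. \<exists>k. homeomorphism UNIV UNIV h k"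
  obtain f g where f: "homotopic_with_canon ?P UNIV UNIV id f" "f ` K = L"
    and g: "homotopic_with_canon ?P UNIV UNIV id g" "g ` L = M"
    using assms unfolding ambient_isotopic_def by blast
  have Pf: "?P f" and cf: "continuous_on UNIV f"
    using homotopic_with_imp_property[OF f(1)] homotopic_with_imp_continuous[OF f(1)] by auto
  \<comment> \<open>Precomposition with the homeomorphism \<open>f\<close> keeps all stages
    homeomorphisms. It turns the isotopy from \<open>id\<close> to \<open>g\<close> into one from
    \<open>f\<close> to \<open>g \<circ> f\<close>, which continues the first isotopy.\<close>
  have "homotopic_with_canon (\<lambda>h. ?P (h \<circ> f)) UNIV UNIV id g"
    using g(1) by (rule homotopic_with_mono) (use Pf homeomorphism_compose in blast)
  then have "homotopic_with_canon ?P UNIV UNIV (id \<circ> f) (g \<circ> f)"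
    using cf by (rule homotopic_with_compose_continuous_right) auto
  then have "homotopic_with_canon ?P UNIV UNIV id (g \<circ> f)"
    using f(1) homotopic_with_trans by auto
  then show ?thesis
    unfolding ambient_isotopic_def using f(2) g(2) by (metis image_comp)
qed

lemma ambient_isotopic_translation: "ambient_isotopic K ((\<lambda>x. x + a) ` K)"
proof (rule ambient_isotopic_straight_line)
  fix t :: real
  have eq: "(1 - t) *\<^sub>R x + t *\<^sub>R (x + a) = x + t *\<^sub>R a" for x :: "real^3"
    by (simp add: algebra_simps)
  show "inj (\<lambda>x. (1 - t) *\<^sub>R x + t *\<^sub>R (x + a))"
    unfolding eq by (simp add: inj_on_def)
  show "surj (\<lambda>x. (1 - t) *\<^sub>R x + t *\<^sub>R (x + a))"
    unfolding eq by (rule surjI[of _ "\<lambda>y. y - t *\<^sub>R a"]) simp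
qed (intro continuous_intros)

text \<open>The assumption \<open>nz\<close> says that \<open>f\<close> has no real eigenvalue \<le>
  0. Then every stage has trivial kernel, which in finite dimension makes it bijective.\<close>

lemma ambient_isotopic_linear:
  fixes f :: "real^3 \<Rightarrow> real^3"
  assumes f: "linear f"
    and nz: "\<And>t x. t \<in> {0..1} \<Longrightarrow> (1 - t) *\<^sub>R x + t *\<^sub>R f x = 0 \<Longrightarrow> x = 0"
  shows "ambient_isotopic K (f ` K)"
proof (rule ambient_isotopic_straight_line)
  show "continuous_on UNIV f"
    using f by (simp add: linear_continuous_on linear_linear)
  fix t :: real assume t: "t \<in> {0..1}"
  have lin: "linear (\<lambda>x. (1 - t) *\<^sub>R x + t *\<^sub>R f x)"
    by (rule linearI) (simp_all add: linear_add[OF f] linear_cmul[OF f] algebra_simps)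
  show inj: "inj (\<lambda>x. (1 - t) *\<^sub>R x + t *\<^sub>R f x)"
    unfolding linear_injective_0[OF lin] using nz[OF t] by blast
  show "surj (\<lambda>x. (1 - t) *\<^sub>R x + t *\<^sub>R f x)"
    by (rule eucl.linear_inj_imp_surj[OF lin inj])
qed

text \<open>Pushes the unit sphere of the gauge \<open>F\<close> onto the round sphere along rays from the origin, so
  every linear subspace is preserved.\<close>

lemma ambient_isotopic_radial:
  fixes F :: "real^3 \<Rightarrow> real"
  assumes F: "continuous_on UNIV F" and pos: "\<And>x. x \<noteq> 0 \<Longrightarrow> F x > 0"
    and hom: "\<And>s x. s \<ge> 0 \<Longrightarrow> F (s *\<^sub>R x) = s * F x"
  shows "ambient_isotopic K ((\<lambda>x. (F x / norm x) *\<^sub>R x) ` K)"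
proof (rule ambient_isotopic_straight_line)
  let ?f = "\<lambda>x. (F x / norm x) *\<^sub>R x"
  have F0: "F 0 = 0" using hom[of 0 0] by simp
  have "isCont ?f x" for x
  proof (cases "x = 0")
    case False
    have "isCont F x" using F by (simp add: continuous_on_eq_continuous_at)
    then show ?thesis using False by (intro continuous_intros) auto
  next
    case True
    \<comment> \<open>The factor \<open>F x / norm x\<close> need not converge at the origin, but
      \<open>?f x\<close> has norm |F x|, which tends to \<open>F 0 = 0\<close>.\<close>
    have "isCont F 0" using F by (simp add: continuous_on_eq_continuous_at)
    then have "F \<midarrow>0\<rightarrow> 0" using F0 by (simp add: isCont_def)
    then have "(\<lambda>x. \<bar>F x\<bar>) \<midarrow>0\<rightarrow> 0" by (rule tendsto_rabs_zero)
    moreover have "\<forall>\<^sub>F x in at 0. \<bar>F x\<bar> = norm (?f x)"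
      by (auto simp: eventually_at_filter)
    ultimately have "(\<lambda>x. norm (?f x)) \<midarrow>0\<rightarrow> 0" by (rule Lim_transform_eventually)
    then have "?f \<midarrow>0\<rightarrow> 0" by (rule tendsto_norm_zero_cancel)
    then show ?thesis using True by (simp add: isCont_def)
  qed
  then show "continuous_on UNIV ?f" by (simp add: continuous_on_eq_continuous_at)
  fix t :: real assume t: "t \<in> {0..1}"
  \<comment> \<open>Each stage multiplies \<open>x\<close> by \<open>\<phi> x\<close>, which is
    positive and constant along every open ray from the origin. So each ray is stretched linearly
    onto itself, and dividing by \<open>\<phi>\<close> inverts the stage.\<close>
  define \<phi> where "\<phi> = (\<lambda>x. (1 - t) + t * (F x / norm x))"
  have eq: "(\<lambda>x. (1 - t) *\<^sub>R x + t *\<^sub>R ?f x) = (\<lambda>x. \<phi> x *\<^sub>R x)"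
    by (simp add: \<phi>_def algebra_simps fun_eq_iff)
  have \<phi>pos: "\<phi> x > 0" if "x \<noteq> 0" for x
  proof -
    have "F x / norm x > 0" using pos[OF that] that by simp
    then have "t = 0 \<or> t * (F x / norm x) > 0"
      using t by (metis atLeastAtMost_iff less_eq_real_def mult_pos_pos)
    then show ?thesis using t unfolding \<phi>_def by auto
  qed
  have \<phi>hom: "\<phi> (s *\<^sub>R x) = \<phi> x" if "s > 0" for s x
    using that by (simp add: \<phi>_def hom)
  show "inj (\<lambda>x. (1 - t) *\<^sub>R x + t *\<^sub>R ?f x)"
    unfolding eq
  proof (rule injI)
    fix x y :: "real^3"
    assume xy: "\<phi> x *\<^sub>R x = \<phi> y *\<^sub>R y"
    show "x = y"
    proof (cases "x = 0 \<or> y = 0")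
      case True
      then show ?thesis using xy \<phi>pos by (metis less_irrefl scaleR_eq_0_iff)
    next
      case False
      then have p: "\<phi> x > 0" "\<phi> y > 0" using \<phi>pos by auto
      have "x = (1 / \<phi> x) *\<^sub>R (\<phi> x *\<^sub>R x)" using p by simp
      also have "\<dots> = (\<phi> y / \<phi> x) *\<^sub>R y" using xy by simp
      finally have x: "x = (\<phi> y / \<phi> x) *\<^sub>R y" .
      have "\<phi> x = \<phi> y" using \<phi>hom[of "\<phi> y / \<phi> x" y] x p by simp
      then show ?thesis using xy p by simp
    qed
  qed
  show "surj (\<lambda>x. (1 - t) *\<^sub>R x + t *\<^sub>R ?f x)"
    unfolding eq
  proof (rule surjI)
    fix y :: "real^3"
    show "\<phi> ((1 / \<phi> y) *\<^sub>R y) *\<^sub>R (1 / \<phi> y) *\<^sub>R y = y"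
      using \<phi>pos[of y] \<phi>hom[of "1 / \<phi> y" y] by (cases "y = 0") auto
  qed
qed

text \<open>Exchanging two coordinates is a reflection and has the eigenvalue -1, so its
  straight-line homotopy degenerates. The quarter turn \<open>f\<close> in the plane of the axes
  \<open>i\<close> and 3, with inverse \<open>g\<close>, avoids this.\<close>

lemma trivial_knot_circle:
  "trivial_knot {x. norm x = 1 \<and> x $ i = 0}"
proof (cases "i = 3")
  case True
  have "ambient_isotopic unknot ((\<lambda>x. x) ` unknot)"
    by (rule ambient_isotopic_linear) (auto simp: linear_iff algebra_simps)
  then show ?thesis using True by (simp add: trivial_knot_def unknot_def)
next
  case False
  define f :: "real^3 \<Rightarrow> real^3" where "f x = (\<chi> l. if l = i then - x $ 3 else if l = 3 then x $ i else x $ l)" for x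
  define g :: "real^3 \<Rightarrow> real^3" where "g x = (\<chi> l. if l = i then x $ 3 else if l = 3 then - x $ i else x $ l)" for x
  have lin: "linear f"
    by (rule linearI) (auto simp: f_def vec_eq_iff)
  have norm2: "norm (f x) = norm x" for x
  proof -
    have "f x \<bullet> f x = x \<bullet> x"
      using False exhaust_3[of i] by (auto simp: inner_vec_def f_def sum_3)
    then show ?thesis by (simp add: norm_eq_sqrt_inner)
  qed
  have fg: "f (g x) = x" "g (f x) = x" for x
    using False by (auto simp: f_def g_def vec_eq_iff)
  have "ambient_isotopic {x. norm x = 1 \<and> x $ i = 0} (f ` {x. norm x = 1 \<and> x $ i = 0})"
  proof (rule ambient_isotopic_linear[OF lin])
    fix t :: real and x :: "real^3"
    assume t: "t \<in> {0..1}" and 0: "(1 - t) *\<^sub>R x + t *\<^sub>R f x = 0"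
    have a: "(1 - t) * x $ i - t * x $ 3 = 0" and b: "(1 - t) * x $ 3 + t * x $ i = 0"
      using arg_cong[OF 0, of "\<lambda>x. x $ i"] arg_cong[OF 0, of "\<lambda>x. x $ 3"] False
      by (auto simp: f_def)
    \<comment> \<open>Cramer's rule for the two equations \<open>a\<close> and \<open>b\<close>;
      their determinant \<open>(1 - t)\<^sup>2 + t\<^sup>2\<close> never vanishes.\<close>
    have "((1 - t)\<^sup>2 + t\<^sup>2) * x $ i = (1 - t) * ((1 - t) * x $ i - t * x $ 3) + t * ((1 - t) * x $ 3 + t * x $ i)"
      by (simp add: algebra_simps power2_eq_square)
    then have i0: "((1 - t)\<^sup>2 + t\<^sup>2) * x $ i = 0" unfolding a b by simp
    have "((1 - t)\<^sup>2 + t\<^sup>2) * x $ 3 = (1 - t) * ((1 - t) * x $ 3 + t * x $ i) - t * ((1 - t) * x $ i - t * x $ 3)"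
      by (simp add: algebra_simps power2_eq_square)
    then have i3: "((1 - t)\<^sup>2 + t\<^sup>2) * x $ 3 = 0" unfolding a b by simp
    have nz: "(1 - t)\<^sup>2 + t\<^sup>2 \<noteq> 0" by (simp add: sum_power2_eq_zero_iff)
    have "x $ l = 0" for l
    proof (cases "l = i \<or> l = 3")
      case True then show ?thesis using i0 i3 nz by auto
    next
      case False
      then show ?thesis using arg_cong[OF 0, of "\<lambda>x. x $ l"]
        by (auto simp: f_def algebra_simps)
    qed
    then show "x = 0" by (simp add: vec_eq_iff)
  qed
  moreover have "f ` {x. norm x = 1 \<and> x $ i = 0} = unknot"
  proof -
    have "x \<in> f ` {x. norm x = 1 \<and> x $ i = 0}" if "x \<in> unknot" for x
      using that fg(1)[of x] norm2[of "g x"] 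
      by (intro image_eqI[of _ _ "g x"]) (auto simp: unknot_def g_def)
    then show ?thesis using norm2 False by (auto simp: unknot_def f_def)
  qed
  ultimately show ?thesis by (simp add: trivial_knot_def)
qed

section \<open>Unknotting rectangles in coordinate planes\<close>

definition rectangle :: "3 \<Rightarrow> 3 \<Rightarrow> 3 \<Rightarrow> real \<Rightarrow> real \<Rightarrow> real \<Rightarrow> real \<Rightarrow> real \<Rightarrow> (real^3) set" where
  "rectangle i j k c a b m M = {x. x $ i = c \<and>
     (x $ j \<in> {a, b} \<and> x $ k \<in> {m..M} \<or> x $ j \<in> {a..b} \<and> x $ k \<in> {m, M})}"

text \<open>Once centred at the origin, the rectangle is the section of the surface of a box by the
  plane \<open>x $ i = 0\<close>. The radial map of the gauge of this box preserves the plane and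
  rounds the section to a circle.\<close>

lemma trivial_knot_rectangle:
  assumes ijk: "i \<noteq> j" "i \<noteq> k" "j \<noteq> k" and ab: "a < b" and mM: "m < M"
  shows "trivial_knot (rectangle i j k c a b m M)"
proof -
  let ?R = "rectangle i j k c a b m M"
  define A where "A = (b - a) / 2"
  define B where "B = (M - m) / 2"
  have AB: "A > 0" "B > 0" using ab mM by (auto simp: A_def B_def)
  define z :: "real^3" where "z = (\<chi> l. if l = i then - c else if l = j then - (a + b) / 2 else - (m + M) / 2)"
  have z: "z $ i = - c" "z $ j = - (a + b) / 2" "z $ k = - (m + M) / 2"
    using ijk by (auto simp: z_def)
  \<comment> \<open>The gauge of the box with half-sides \<open>A\<close>, \<open>B\<close> and 1.
    The last term vanishes on the plane of the rectangle and makes \<open>F\<close> positive on the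
    normal axis.\<close>
  define F :: "real^3 \<Rightarrow> real" where "F x = max (max (\<bar>x $ j\<bar> / A) (\<bar>x $ k\<bar> / B)) \<bar>x $ i\<bar>" for x
  have all: "l = i \<or> l = j \<or> l = k" for l
    using ijk exhaust_3[of i] exhaust_3[of j] exhaust_3[of k] exhaust_3[of l] by auto
  have "(\<lambda>x. x + z) ` ?R = {x. x $ i = 0 \<and> F x = 1}"
  proof -
    have 1: "x + z \<in> {x. x $ i = 0 \<and> F x = 1} \<longleftrightarrow> x \<in> ?R" for x
    proof -
      define p where "p = \<bar>(x + z) $ j\<bar> / A"
      define q where "q = \<bar>(x + z) $ k\<bar> / B"
      have p: "p = 1 \<longleftrightarrow> x $ j \<in> {a, b}" "p \<le> 1 \<longleftrightarrow> x $ j \<in> {a..b}"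
        using ab by (auto simp: p_def z A_def field_simps abs_if)
      have q: "q = 1 \<longleftrightarrow> x $ k \<in> {m, M}" "q \<le> 1 \<longleftrightarrow> x $ k \<in> {m..M}"
        using mM by (auto simp: q_def z B_def field_simps abs_if)
      have "max (max p q) 0 = 1 \<longleftrightarrow> p = 1 \<and> q \<le> 1 \<or> p \<le> 1 \<and> q = 1"
        by (auto simp: max_def)
      then have "(x + z) $ i = 0 \<Longrightarrow> F (x + z) = 1 \<longleftrightarrow> p = 1 \<and> q \<le> 1 \<or> p \<le> 1 \<and> q = 1"
        unfolding F_def p_def q_def by simp
      then show ?thesis
        unfolding p q rectangle_def by (auto simp: z)
    qed
    then have "x \<in> (\<lambda>x. x + z) ` ?R" if "x $ i = 0 \<and> F x = 1" for x
      using that 1[of "x - z"] by (intro image_eqI[of _ _ "x - z"]) auto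
    moreover have "x + z \<in> {x. x $ i = 0 \<and> F x = 1}" if "x \<in> ?R" for x
      using that 1 by blast
    ultimately show ?thesis by blast
  qed
  then have 1: "ambient_isotopic ?R {x. x $ i = 0 \<and> F x = 1}"
    by (metis ambient_isotopic_translation)
  let ?f = "\<lambda>x. (F x / norm x) *\<^sub>R x"
  have Fpos: "F x > 0" if "x \<noteq> 0" for x
  proof -
    obtain l where "x $ l \<noteq> 0" using \<open>x \<noteq> 0\<close> by (metis vec_eq_iff zero_index)
    then show ?thesis using all[of l] AB by (auto simp: F_def less_max_iff_disj)
  qed
  have Fhom: "F (s *\<^sub>R x) = s * F x" if "s \<ge> 0" for s x
    using that by (simp add: F_def abs_mult max_mult_distrib_left)
  have "continuous_on UNIV F"
    unfolding F_def using AB by (intro continuous_intros) auto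
  then have "ambient_isotopic {x. x $ i = 0 \<and> F x = 1} (?f ` {x. x $ i = 0 \<and> F x = 1})"
    using Fpos Fhom by (rule ambient_isotopic_radial)
  also have "?f ` {x. x $ i = 0 \<and> F x = 1} = {x. norm x = 1 \<and> x $ i = 0}"
  proof -
    have F0: "F 0 = 0" using Fhom[of 0 0] by simp
    have "x \<in> ?f ` {x. x $ i = 0 \<and> F x = 1}" if "norm x = 1" "x $ i = 0" for x
    proof -
      have "x \<noteq> 0" using that by auto
      then show ?thesis using that Fpos[of x] Fhom[of "1 / F x" x]
        by (intro image_eqI[of _ _ "(1 / F x) *\<^sub>R x"]) auto
    qed
    moreover have "norm (?f x) = 1" if "F x = 1" for x
      using that F0 by auto
    ultimately show ?thesis by auto
  qed
  finally show ?thesis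
    using 1 trivial_knot_circle[of i] ambient_isotopic_trans unfolding trivial_knot_def by blast
qed

subsection \<open>Segments and sticks\<close>

lemma segment_param:
  fixes u w :: "'a::real_vector"
  assumes "x \<in> closed_segment u w" "y \<in> closed_segment u w"
  obtains t where "y - x = t *\<^sub>R (w - u)"
proof -
  have *: "\<exists>s. z = u + s *\<^sub>R (w - u)" if "z \<in> closed_segment u w" for z
    using that unfolding closed_segment_image_interval
    by auto (metis add.commute diff_add_eq scaleR_diff_right scaleR_left_diff_distrib scaleR_one add_diff_eq)
  obtain s t where "x = u + s *\<^sub>R (w - u)" "y = u + t *\<^sub>R (w - u)"
    using assms * by blast
  then have "y - x = (t - s) *\<^sub>R (w - u)" by (simp add: scaleR_diff_left)
  then show ?thesis by (rule that)
qed

lemma segment_height_const: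
  fixes S :: "'a::real_inner set"
  assumes S: "S = closed_segment u w" and "x \<in> S" "y \<in> S" "x \<noteq> y" "v \<bullet> x = v \<bullet> y" "z \<in> S"
  shows "v \<bullet> z = v \<bullet> x"
proof -
  obtain s t where st: "y - x = s *\<^sub>R (w - u)" "z - x = t *\<^sub>R (w - u)"
    using assms segment_param by metis
  have "s * (v \<bullet> (w - u)) = v \<bullet> (y - x)" by (simp add: st)
  also have "\<dots> = 0" using assms by (simp add: inner_diff_right)
  finally have "v \<bullet> (w - u) = 0" using st assms by auto
  then have "v \<bullet> (z - x) = 0" by (simp add: st)
  then show ?thesis by (simp add: inner_diff_right)
qed

lemma collinear_Un:
  fixes S T :: "'a::euclidean_space set"
  assumes "collinear S" "collinear T" "x \<in> S \<inter> T" "y \<in> S \<inter> T" "x \<noteq> y"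
  shows "collinear (S \<union> T)"
proof -
  have "z \<in> affine hull {x, y}" if "z \<in> S \<union> T" for z
  proof -
    have "collinear {x, y, z}"
      using that assms collinear_subset[of S "{x, y, z}"] collinear_subset[of T "{x, y, z}"] by auto
    then show ?thesis using assms(5) collinear_3_affine_hull by blast
  qed
  then show ?thesis unfolding collinear_affine_hull by blast
qed

text \<open>A nonempty compact connected collinear set is a segment.\<close>

lemma segment_Un:
  fixes a b c d :: "'a::euclidean_space"
  assumes "closed_segment a b \<inter> closed_segment c d \<noteq> {}"
    and "collinear (closed_segment a b \<union> closed_segment c d)"
  obtains u w where "closed_segment a b \<union> closed_segment c d = closed_segment u w"
proof -
  have "connected (closed_segment a b \<union> closed_segment c d)"
    using assms(1) by (intro connected_Un) auto
  then show ?thesis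
    using compact_convex_collinear_segment_alt[of "closed_segment a b \<union> closed_segment c d"] assms that
    by (metis Int_empty_left Un_empty compact_Un compact_segment)
qed

lemma closed_segment_nontrivial:
  fixes u w :: "'a::euclidean_space"
  assumes "x \<in> closed_segment u w" "y \<in> closed_segment u w" "x \<noteq> y"
  shows "u \<noteq> w"
  using assms by (metis closed_segment_idem singletonD)

text \<open>The maximal segment is the component of \<open>a\<close> in the intersection of
  \<open>K\<close> with the line through \<open>a\<close> and \<open>b\<close>: it is compact,
  connected and collinear, hence a segment, and any segment of \<open>K\<close> containing it stays
  on that line and in that component.\<close>

lemma stick_exists:
  assumes K: "compact K" and ab: "a \<noteq> b" "closed_segment a b \<subseteq> K"
  obtains S where "S \<in> sticks K" "closed_segment a b \<subseteq> S"
proof -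
  define M where "M = K \<inter> affine hull {a, b}"
  define S where "S = connected_component_set M a"
  have ab_hull: "closed_segment a b \<subseteq> affine hull {a, b}"
    by (simp add: convex_hull_subset_affine_hull segment_convex_hull)
  have "compact M"
    unfolding M_def by (simp add: K closed_affine_hull compact_Int_closed)
  have a: "a \<in> M" using ab ab_hull by (auto simp: M_def)
  have sub: "T \<subseteq> S" if "connected T" "T \<subseteq> M" "a \<in> T" for T
    unfolding S_def using that by (simp add: connected_component_maximal)
  have abS: "closed_segment a b \<subseteq> S"
    using ab ab_hull by (intro sub) (auto simp: M_def)
  have SM: "S \<subseteq> M" unfolding S_def by (rule connected_component_subset)
  have "compact S"
    unfolding S_def using \<open>compact M\<close> by (rule compact_components) (simp add: a componentsI)
  moreover have "connected S" unfolding S_def by simp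
  moreover have "collinear S"
    using SM unfolding M_def collinear_affine_hull by blast
  moreover have "S \<noteq> {}" using abS by auto
  ultimately obtain u w where uw: "S = closed_segment u w"
    using compact_convex_collinear_segment_alt by blast
  have "u \<noteq> w" using closed_segment_nontrivial[of a u w b] abS uw ab by auto
  moreover have "S' = S" if "line_segment_in K S'" "S \<subseteq> S'" for S'
  proof -
    obtain c d where S': "S' = closed_segment c d" "S' \<subseteq> K"
      using \<open>line_segment_in K S'\<close> unfolding line_segment_in_def by blast
    have "S' \<subseteq> affine hull {a, b}"
    proof
      fix z assume "z \<in> S'"
      then have "collinear {a, b, z}"
        using abS \<open>S \<subseteq> S'\<close> S' by (intro collinear_subset[OF collinear_closed_segment[of c d]]) auto
      then show "z \<in> affine hull {a, b}" using ab collinear_3_affine_hull by blast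
    qed
    then have "S' \<subseteq> S"
      using S' abS \<open>S \<subseteq> S'\<close> by (intro sub) (auto simp: M_def)
    then show ?thesis using that by auto
  qed
  ultimately have "S \<in> sticks K"
    using SM uw unfolding sticks_def line_segment_in_def M_def by blast
  then show ?thesis using abS that by blast
qed

lemma sticks_segment:
  assumes "S \<in> sticks K"
  obtains u w where "S = closed_segment u w" "u \<noteq> w" "S \<subseteq> K"
  using assms unfolding sticks_def line_segment_in_def by blast

text \<open>The union is again a segment inside \<open>K\<close>, so maximality of the stick leaves
  no room for an extension.\<close>

lemma stick_absorbs:
  assumes S: "S \<in> sticks K" and ab: "closed_segment a b \<subseteq> K" "S \<inter> closed_segment a b \<noteq> {}"
    and "collinear (S \<union> closed_segment a b)"
  shows "closed_segment a b \<subseteq> S"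
proof -
  obtain u w where uw: "S = closed_segment u w" "u \<noteq> w" "S \<subseteq> K"
    using S by (rule sticks_segment)
  obtain c d where cd: "S \<union> closed_segment a b = closed_segment c d"
    using segment_Un[of u w a b] assms uw by metis
  have "c \<noteq> d" using closed_segment_nontrivial[of u c d w] cd uw by auto
  then have "line_segment_in K (S \<union> closed_segment a b)"
    using cd uw ab unfolding line_segment_in_def by blast
  then show ?thesis using S unfolding sticks_def by blast
qed

text \<open>Two common points put both sticks on one line, where each absorbs the other.\<close>

lemma sticks_eqI:
  assumes "S \<in> sticks K" "T \<in> sticks K" "x \<in> S \<inter> T" "y \<in> S \<inter> T" "x \<noteq> y"
  shows "S = T"
proof -
  have *: "T \<subseteq> S" if ST: "S \<in> sticks K" "T \<in> sticks K" "x \<in> S \<inter> T" "y \<in> S \<inter> T" for S T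
  proof -
    obtain u w where S: "S = closed_segment u w" using ST(1) by (rule sticks_segment)
    obtain c d where T: "T = closed_segment c d" "T \<subseteq> K" using ST(2) by (rule sticks_segment)
    have "collinear (S \<union> T)"
      by (rule collinear_Un[of _ _ x y]) (use S T ST \<open>x \<noteq> y\<close> in auto)
    then show ?thesis
      using stick_absorbs[OF ST(1), of c d] T ST(3) by blast
  qed
  show ?thesis using *[of S T] *[of T S] assms by blast
qed

text \<open>Height is affine along a segment: if it were larger at \<open>q\<close> than at
  \<open>x\<close>, it would already increase inside \<open>U\<close>.\<close>

lemma local_maximum_height_le:
  assumes C: "C \<in> components {x \<in> K. v \<bullet> x = c}"
    and U: "open U" "C \<subseteq> U" "\<forall>y\<in>K \<inter> U. v \<bullet> y \<le> c"
    and x: "x \<in> C" and seg: "closed_segment x q \<subseteq> K"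
  shows "v \<bullet> q \<le> c"
proof (rule ccontr)
  assume "\<not> v \<bullet> q \<le> c"
  then have q: "v \<bullet> q > c" by simp
  have vx: "v \<bullet> x = c" using C x in_components_subset by blast
  have "x \<in> U" using U x by auto
  then obtain e where e: "e > 0" "ball x e \<subseteq> U" using U openE by metis
  have "q \<noteq> x" using q vx by auto
  \<comment> \<open>Moves \<open>x\<close> by at most \<open>e / 2\<close>, and not beyond
    \<open>q\<close>.\<close>
  define t where "t = min 1 (e / (2 * dist x q))"
  have t: "0 < t" "t \<le> 1" "t * dist x q < e"
    using e \<open>q \<noteq> x\<close> by (auto simp: t_def min_def field_simps)
  define y where "y = x + t *\<^sub>R (q - x)"
  have "y \<in> closed_segment x q"
    using t by (auto simp: y_def in_segment algebra_simps intro!: exI[of _ t])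
  moreover have "dist x y = t * dist x q"
    using t by (simp add: y_def dist_norm norm_minus_commute)
  then have "y \<in> ball x e" using t by simp
  ultimately have "v \<bullet> y \<le> c" using seg U(3) e(2) by (meson IntI subsetD)
  moreover have "v \<bullet> y = c + t * (v \<bullet> q - c)"
    by (simp add: y_def vx inner_add_right inner_diff_right algebra_simps)
  moreover have "t * (v \<bullet> q - c) > 0" using t q by simp
  ultimately show False by simp
qed

subsection \<open>Simple closed polygons\<close>

locale simple_polygon =
  fixes vs :: "(real^3) list"
  assumes simple: "simple_closed_polygon vs"
begin

definition n :: nat where "n = length vs"

definition K :: "(real^3) set" where "K = polygon_image vs"

text \<open>All natural numbers serve as indices, so that inductions along the polygon can go round
  without treating the closing edge separately.\<close>

definition p :: "nat \<Rightarrow> real^3" where "p k = vs ! (k mod n)"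

definition edge :: "nat \<Rightarrow> (real^3) set" where "edge k = closed_segment (p k) (p (Suc k))"

lemma n_ge_3: "3 \<le> n"
  using simple by (simp add: simple_closed_polygon_def n_def)

lemma p_mod [simp]: "p (k mod n) = p k"
  by (simp add: p_def)

lemma p_add_n [simp]: "p (k + n) = p k"
  by (simp add: p_def)

lemma p_eq_iff: "p j = p k \<longleftrightarrow> j mod n = k mod n"
  using simple n_ge_3 unfolding p_def simple_closed_polygon_def n_def
  by (intro nth_eq_iff_index_eq) (auto intro!: mod_less_divisor)

lemma edge_mod [simp]: "edge (k mod n) = edge k"
  by (simp add: edge_def p_def mod_Suc_eq)

lemma polygon_edge_eq: "k < n \<Longrightarrow> polygon_edge vs k = edge k"
  by (simp add: polygon_edge_def edge_def p_def n_def)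

lemma K_eq: "K = (\<Union>k<n. edge k)"
  by (simp add: K_def polygon_image_def polygon_edge_eq flip: n_def)

lemma edge_subset_K: "edge k \<subseteq> K"
proof -
  have "k mod n < n" using n_ge_3 by simp
  then have "edge (k mod n) \<subseteq> K" unfolding K_eq by blast
  then show ?thesis by simp
qed

lemma in_K_E:
  assumes "x \<in> K"
  obtains k where "k < n" "x \<in> edge k"
  using assms unfolding K_eq by blast

lemma p_in_edge [simp]: "p k \<in> edge k" "p (Suc k) \<in> edge k"
  by (auto simp: edge_def)

lemma p_in_K [simp]: "p k \<in> K"
  using edge_subset_K p_in_edge by blast

lemma mod_Suc_neq: "Suc k mod n \<noteq> k mod n"
proof
  assume "Suc k mod n = k mod n"
  then have "n dvd Suc k - k" using mod_eq_dvd_iff_nat[of k "Suc k" n] by simp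
  then show False using n_ge_3 by simp
qed

text \<open>This is where three vertices are required: with two, consecutive edges would share both
  ends.\<close>

lemma mod_Suc_Suc_neq: "Suc (Suc k) mod n \<noteq> k mod n"
proof
  assume "Suc (Suc k) mod n = k mod n"
  then have "n dvd Suc (Suc k) - k" using mod_eq_dvd_iff_nat[of k "Suc (Suc k)" n] by simp
  then show False using n_ge_3 dvd_imp_le[of n 2] by auto
qed

lemma p_Suc_neq: "p (Suc k) \<noteq> p k"
  using mod_Suc_neq by (simp add: p_eq_iff)

lemma edge_Int:
  assumes "j mod n \<noteq> k mod n"
  shows "edge j \<inter> edge k = {p j, p (Suc j)} \<inter> {p k, p (Suc k)}"
proof -
  have lt: "j mod n < n" "k mod n < n" using n_ge_3 by auto
  have "polygon_edge vs (j mod n) \<inter> polygon_edge vs (k mod n) =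
    {vs ! (j mod n), vs ! (Suc (j mod n) mod n)} \<inter> {vs ! (k mod n), vs ! (Suc (k mod n) mod n)}"
    using simple lt assms unfolding simple_closed_polygon_def n_def by blast
  then show ?thesis using lt by (simp add: polygon_edge_eq p_def mod_Suc_eq)
qed

lemma edge_Int_Suc: "edge k \<inter> edge (Suc k) = {p (Suc k)}"
  using edge_Int[of k "Suc k"] mod_Suc_neq[of k] mod_Suc_neq[of "Suc k"] mod_Suc_Suc_neq[of k]
  by (auto simp: p_eq_iff)

text \<open>A common point is an end of all three edges. Each edge either starts or finishes there,
  so two of them do the same and have equal indices modulo \<open>n\<close>.\<close>

lemma three_edges:
  assumes x: "x \<in> edge j" "x \<in> edge k" "x \<in> edge l"
  shows "j mod n = k mod n \<or> j mod n = l mod n \<or> k mod n = l mod n"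
proof (rule ccontr)
  assume neq: "\<not> ?thesis"
  have "x \<in> {p j, p (Suc j)}" "x \<in> {p k, p (Suc k)}" "x \<in> {p l, p (Suc l)}"
    using edge_Int[of j k] edge_Int[of k l] x neq by blast+
  moreover have "Suc a mod n = Suc b mod n \<longleftrightarrow> a mod n = b mod n" for a b
    by (auto simp: mod_Suc)
  ultimately show False using neq by (auto simp: p_eq_iff) metis+
qed

lemma compact_K: "compact K"
  unfolding K_eq edge_def by (intro compact_UN) auto

lemma K_connected: "connected K"
proof -
  have *: "connected_component K (p 0) (p k)" for k
  proof (induction k)
    case 0
    show ?case by (simp add: connected_component_refl)
  next
    case (Suc k)
    have "connected_component K (p k) (p (Suc k))"
      using edge_subset_K[of k] p_in_edge[of k] unfolding connected_component_def
      by (metis connected_segment edge_def)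
    then show ?case using Suc connected_component_trans by blast
  qed
  have "connected_component K (p 0) x" if x: "x \<in> K" for x
  proof -
    obtain k where "x \<in> edge k" using x in_K_E by blast
    then have "connected_component K (p k) x"
      using edge_subset_K[of k] p_in_edge[of k] unfolding connected_component_def
      by (metis connected_segment edge_def)
    then show ?thesis using * connected_component_trans by blast
  qed
  then have "connected_component_set K (p 0) = K"
    using connected_component_subset by blast
  then show ?thesis by (metis connected_connected_component)
qed

text \<open>A stick is infinite and covered by finitely many edges, so it shares two points with one
  of them; that edge is collinear with the stick and is absorbed.\<close>

lemma stick_contains_edge:
  assumes S: "S \<in> sticks K"
  obtains k where "k < n" "edge k \<subseteq> S"
proof -
  obtain u w where uw: "S = closed_segment u w" "u \<noteq> w" "S \<subseteq> K"
    using S by (rule sticks_segment)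
  have "infinite S" using uw by simp
  moreover have "S = (\<Union>k<n. S \<inter> edge k)" using uw K_eq by blast
  ultimately obtain k where k: "k < n" "infinite (S \<inter> edge k)"
    by (metis (no_types, lifting) finite_UN_I finite_lessThan lessThan_iff)
  obtain x y where xy: "x \<in> S \<inter> edge k" "y \<in> S \<inter> edge k" "x \<noteq> y"
    using k(2) by (metis finite.emptyI finite_insert finite_subset insert_iff subsetI)
  then have "collinear (S \<union> edge k)"
    by (intro collinear_Un[of _ _ x y]) (simp_all add: uw edge_def)
  then have "edge k \<subseteq> S"
    using stick_absorbs[OF S, of "p k" "p (Suc k)"] edge_subset_K[of k] xy
    by (auto simp: edge_def)
  then show ?thesis using k that by blast
qed

lemma edge_in_stick:
  obtains S where "S \<in> sticks K" "edge k \<subseteq> S"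
proof -
  have "p k \<noteq> p (Suc k)" using p_Suc_neq[of k] by simp
  moreover have "closed_segment (p k) (p (Suc k)) \<subseteq> K"
    using edge_subset_K[of k] by (simp add: edge_def)
  ultimately obtain S where "S \<in> sticks K" "closed_segment (p k) (p (Suc k)) \<subseteq> S"
    by (rule stick_exists[OF compact_K])
  then show ?thesis using that[of S] by (simp add: edge_def)
qed

lemma sticks_eq_if_common_edge:
  assumes "S \<in> sticks K" "T \<in> sticks K" "edge k \<subseteq> S" "edge k \<subseteq> T"
  shows "S = T"
proof (rule sticks_eqI[OF assms(1,2)])
  show "p (Suc k) \<in> S \<inter> T" "p k \<in> S \<inter> T" using assms(3,4) p_in_edge[of k] by auto
  show "p (Suc k) \<noteq> p k" by (rule p_Suc_neq)
qed

text \<open>Guards against the default value 0 of \<open>card\<close> on infinite sets. An edge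
  chosen in each stick determines the stick.\<close>

lemma finite_sticks: "finite (sticks K)"
proof -
  obtain f where f: "\<And>S. S \<in> sticks K \<Longrightarrow> f S < n \<and> edge (f S) \<subseteq> S"
    using stick_contains_edge[of _ "\<exists>k<n. edge k \<subseteq> _"] by metis
  have "inj_on f (sticks K)"
    by (rule inj_onI) (metis f sticks_eq_if_common_edge)
  moreover have "f ` sticks K \<subseteq> {..<n}" using f by auto
  ultimately show ?thesis by (metis finite_imageD finite_lessThan finite_subset)
qed

section \<open>Sticks not orthogonal to a direction, and local maxima\<close>

definition steep :: "real^3 \<Rightarrow> (real^3) set set" where
  "steep v = {S \<in> sticks K. \<exists>x\<in>S. \<exists>y\<in>S. v \<bullet> x \<noteq> v \<bullet> y}"

lemma finite_steep: "finite (steep v)"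
  unfolding steep_def using finite_sticks by simp

lemma steep_inj:
  assumes "S \<in> steep v" "x \<in> S" "y \<in> S" "v \<bullet> x = v \<bullet> y"
  shows "x = y"
proof (rule ccontr)
  assume "x \<noteq> y"
  obtain u w where "S = closed_segment u w"
    using assms(1) sticks_segment unfolding steep_def by blast
  then have "\<forall>z\<in>S. v \<bullet> z = v \<bullet> x"
    using segment_height_const assms \<open>x \<noteq> y\<close> by blast
  then show False using assms(1) unfolding steep_def by auto
qed

lemma steep_if_edge_steep:
  assumes "S \<in> sticks K" "edge k \<subseteq> S" "v \<bullet> p k \<noteq> v \<bullet> p (Suc k)"
  shows "S \<in> steep v"
  using assms p_in_edge[of k] unfolding steep_def by blast

text \<open>Of three collinear points one lies between the others. It is not \<open>p a\<close>,
  which is higher than both; otherwise one edge contains the far end of the other, although they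
  share only \<open>p a\<close>.\<close>

lemma adjacent_edges_not_nested:
  assumes S: "S = closed_segment u w" "edge a \<subseteq> S" "edge b \<subseteq> S"
    and ab: "Suc b mod n = a mod n"
    and lt: "v \<bullet> p (Suc a) < v \<bullet> p a" "v \<bullet> p b < v \<bullet> p a"
  shows False
proof -
  have pab: "p (Suc b) = p a" using ab by (simp add: p_eq_iff)
  have Sab: "edge (Suc b) = edge a" using ab edge_mod by metis
  have Int: "edge b \<inter> edge a = {p a}"
    using edge_Int_Suc[of b] by (simp add: Sab pab)
  have lt_seg: "v \<bullet> z < v \<bullet> p a" if "z \<in> closed_segment x y" "v \<bullet> x < v \<bullet> p a" "v \<bullet> y < v \<bullet> p a" for x y z
  proof -
    have "closed_segment x y \<subseteq> {z. v \<bullet> z < v \<bullet> p a}"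
      using that by (intro closed_segment_subset convex_halfspace_lt) auto
    then show ?thesis using that by blast
  qed
  have "collinear {p a, p (Suc a), p b}"
    using S p_in_edge[of a] p_in_edge[of b] by (intro collinear_subset[OF collinear_closed_segment[of u w]]) auto
  then consider "p a \<in> closed_segment (p (Suc a)) (p b)" | "p (Suc a) \<in> closed_segment (p b) (p a)"
    | "p b \<in> closed_segment (p a) (p (Suc a))"
    by (auto simp: collinear_between_cases between_mem_segment)
  then show False
  proof cases
    case 1
    then show False using lt_seg[of "p a"] lt by auto
  next
    case 2
    then have "p (Suc a) \<in> edge b \<inter> edge a" by (simp add: edge_def pab)
    then show False using Int p_Suc_neq[of a] by auto
  next
    case 3
    then have "p b \<in> edge b \<inter> edge a" by (simp add: edge_def[of a])
    then show False using Int p_Suc_neq[of b] pab by auto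
  qed
qed

text \<open>Walking forwards and backwards from a vertex of \<open>C\<close> must meet a descending
  edge, as otherwise all vertices would have height \<open>c\<close>. If both descending edges lay
  in one stick, its unique point at height \<open>c\<close> would be a common vertex of them, and
  they would overlap.\<close>

lemma local_maximum_two_sticks:
  assumes C: "C \<in> local_maxima v K" and nonflat: "\<And>c. \<exists>x\<in>K. v \<bullet> x \<noteq> c"
  obtains S T x y where "S \<in> steep v" "T \<in> steep v" "S \<noteq> T" "x \<in> S \<inter> C" "y \<in> T \<inter> C"
    "\<And>z. z \<in> S \<Longrightarrow> v \<bullet> z \<le> v \<bullet> x" "\<And>z. z \<in> T \<Longrightarrow> v \<bullet> z \<le> v \<bullet> y"
proof -
  obtain c U where comp: "C \<in> components {x \<in> K. v \<bullet> x = c}"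
    and U: "open U" "C \<subseteq> U" "\<forall>y\<in>K \<inter> U. v \<bullet> y \<le> c"
    using C unfolding local_maxima_def by blast
  have CK: "C \<subseteq> K" and Cc: "\<And>x. x \<in> C \<Longrightarrow> v \<bullet> x = c"
    using in_components_subset[OF comp] by auto
  have top: "v \<bullet> z \<le> c" if "S = closed_segment u w" "S \<subseteq> K" "x \<in> S \<inter> C" "z \<in> S" for S u w x z
  proof (rule local_maximum_height_le[OF comp U, of x])
    have "closed_segment x z \<subseteq> S" using that by (simp add: subset_closed_segment)
    then show "closed_segment x z \<subseteq> K" using that by blast
  qed (use that in simp)
  have top_edge: "v \<bullet> z \<le> c" if "x \<in> edge k \<inter> C" "z \<in> edge k" for x z k
    using that edge_subset_K[of k] unfolding edge_def by (metis top)
  have flat: "edge k \<subseteq> C" if "x \<in> edge k \<inter> C" "v \<bullet> p k = c" "v \<bullet> p (Suc k) = c" for x k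
  proof -
    have "edge k \<subseteq> {z. v \<bullet> z = c}"
      unfolding edge_def using that by (intro closed_segment_subset convex_hyperplane) auto
    then have "edge k \<subseteq> {x \<in> K. v \<bullet> x = c}" using edge_subset_K by blast
    moreover have "connected (edge k)" by (simp add: edge_def)
    ultimately show ?thesis using components_maximal[OF comp] that(1) by blast
  qed
  have not_all: "\<exists>k<n. v \<bullet> p k \<noteq> c"
  proof (rule ccontr)
    assume "\<not> ?thesis"
    then have pc: "v \<bullet> p k = c" for k
      using n_ge_3 by (metis p_mod gr0I mod_less_divisor not_numeral_le_zero)
    have "edge k \<subseteq> {z. v \<bullet> z = c}" for k
      unfolding edge_def using pc by (intro closed_segment_subset convex_hyperplane) auto
    then show False using nonflat[of c] unfolding K_eq by blast
  qed
  \<comment> \<open>The height at a point of an edge is a weighted mean of the heights of its ends,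
    both at most \<open>c\<close>. So either the whole edge is flat and lies in \<open>C\<close>, or
    the point is an end.\<close>
  obtain k where k: "p k \<in> C"
  proof -
    obtain x where x: "x \<in> C" using in_components_nonempty[OF comp] by blast
    then obtain k where xk: "x \<in> edge k" using CK in_K_E by blast
    have le: "v \<bullet> p k \<le> c" "v \<bullet> p (Suc k) \<le> c"
      using top_edge[of x k] x xk by auto
    show ?thesis
    proof (cases "v \<bullet> p k = c \<and> v \<bullet> p (Suc k) = c")
      case True
      then show ?thesis using flat[of x k] x xk that p_in_edge by blast
    next
      case False
      obtain t where t: "0 \<le> t" "t \<le> 1" "x = (1 - t) *\<^sub>R p k + t *\<^sub>R p (Suc k)"
        using xk by (auto simp: edge_def in_segment)
      have "(1 - t) * (v \<bullet> p k) + t * (v \<bullet> p (Suc k)) = c"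
        using Cc[OF x] t by (simp add: inner_add_right)
      then have 0: "(1 - t) * (c - v \<bullet> p k) + t * (c - v \<bullet> p (Suc k)) = 0"
        by (simp add: algebra_simps)
      have "(1 - t) * (c - v \<bullet> p k) \<ge> 0" "t * (c - v \<bullet> p (Suc k)) \<ge> 0"
        using t le by auto
      then have "(1 - t) * (c - v \<bullet> p k) = 0" "t * (c - v \<bullet> p (Suc k)) = 0"
        using 0 by linarith+
      then have "t = 0 \<or> t = 1" using False by auto
      then show ?thesis using t x that by auto
    qed
  qed
  have "\<exists>a. p a \<in> C \<and> v \<bullet> p (Suc a) < c"
  proof (rule ccontr)
    assume no: "\<nexists>a. p a \<in> C \<and> v \<bullet> p (Suc a) < c"
    have step: "p (Suc m) \<in> C" if m: "p m \<in> C" for m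
    proof -
      have "v \<bullet> p (Suc m) = c"
        using top_edge[of "p m" m "p (Suc m)"] no m by (simp add: antisym_conv1)
      then show ?thesis using flat[of "p m" m] Cc[OF m] m p_in_edge by blast
    qed
    have all: "p (k + m) \<in> C" for m
      by (induction m) (use k step in auto)
    have "v \<bullet> p j = c" for j
    proof -
      \<comment> \<open>Adding the multiple \<open>n * k\<close> of the period moves the index
        \<open>j\<close> past the starting index \<open>k\<close> of the forward walk.\<close>
      have "k \<le> n * k + j" using n_ge_3 by (simp add: trans_le_add1)
      then have "p (k + (n * k + j - k)) = p j" by (simp add: p_eq_iff)
      then show ?thesis using all Cc by metis
    qed
    then show False using not_all by blast
  qed
  then obtain a where a: "p a \<in> C" "v \<bullet> p (Suc a) < c" by blast
  have "\<exists>b. p (Suc b) \<in> C \<and> v \<bullet> p b < c"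
  proof (rule ccontr)
    assume no: "\<nexists>b. p (Suc b) \<in> C \<and> v \<bullet> p b < c"
    have step: "p m \<in> C" if m: "p (Suc m) \<in> C" for m
    proof -
      have "v \<bullet> p m = c"
        using top_edge[of "p (Suc m)" m "p m"] no m by (simp add: antisym_conv1)
      then show ?thesis using flat[of "p (Suc m)" m] Cc[OF m] m p_in_edge by blast
    qed
    \<comment> \<open>The backward walk starts at \<open>k + n\<close>, another index of the vertex
      \<open>p k\<close>, so that it passes all of 0 to \<open>n - 1\<close>.\<close>
    have "p m \<in> C" if "m \<le> k + n" for m
      using that by (rule inc_induct) (use k step in auto)
    then have "v \<bullet> p j = c" if "j < n" for j
      using that Cc by simp
    then show False using not_all by blast
  qed
  then obtain b where b: "p (Suc b) \<in> C" "v \<bullet> p b < c" by blast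
  obtain S where S: "S \<in> sticks K" "edge a \<subseteq> S" by (rule edge_in_stick)
  obtain T where T: "T \<in> sticks K" "edge b \<subseteq> T" by (rule edge_in_stick)
  have ca: "v \<bullet> p a = c" and cb: "v \<bullet> p (Suc b) = c" using a b Cc by auto
  have steep: "S \<in> steep v" "T \<in> steep v"
    using steep_if_edge_steep[OF S] steep_if_edge_steep[OF T] a b ca cb by auto
  have aS: "p a \<in> S \<inter> C" and bT: "p (Suc b) \<in> T \<inter> C"
    using S T a b p_in_edge by blast+
  have "S \<noteq> T"
  proof
    assume ST: "S = T"
    then have "p a = p (Suc b)"
      using steep_inj[OF steep(1), of "p a" "p (Suc b)"] aS bT ca cb by auto
    moreover obtain u w where "S = closed_segment u w" using S(1) by (rule sticks_segment)
    ultimately show False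
      using adjacent_edges_not_nested[of S u w a b v] S T ST a b ca by (auto simp: p_eq_iff)
  qed
  moreover have "v \<bullet> z \<le> v \<bullet> p a" if "z \<in> S" for z
    using S(1) aS that ca by (metis sticks_segment top)
  moreover have "v \<bullet> z \<le> v \<bullet> p (Suc b)" if "z \<in> T" for z
    using T(1) bT that cb by (metis sticks_segment top)
  ultimately show ?thesis using that steep aS bT by blast
qed

lemma card_steep_ge:
  assumes nonflat: "\<And>c. \<exists>x\<in>K. v \<bullet> x \<noteq> c"
  shows "2 * card (local_maxima v K) \<le> card (steep v)"
proof -
  have "\<forall>C\<in>local_maxima v K. \<exists>S T. S \<in> steep v \<and> T \<in> steep v \<and> S \<noteq> T \<and>
    (\<exists>x\<in>S \<inter> C. \<forall>z\<in>S. v \<bullet> z \<le> v \<bullet> x) \<and> (\<exists>x\<in>T \<inter> C. \<forall>z\<in>T. v \<bullet> z \<le> v \<bullet> x)"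
    using local_maximum_two_sticks[OF _ nonflat] by metis
  then obtain f g where fg: "\<And>C. C \<in> local_maxima v K \<Longrightarrow> f C \<in> steep v \<and> g C \<in> steep v \<and> f C \<noteq> g C \<and>
    (\<exists>x\<in>f C \<inter> C. \<forall>z\<in>f C. v \<bullet> z \<le> v \<bullet> x) \<and> (\<exists>x\<in>g C \<inter> C. \<forall>z\<in>g C. v \<bullet> z \<le> v \<bullet> x)"
    by metis
  \<comment> \<open>The highest point of a steep stick is unique. Its height determines the level
    set and its position the component, so two local maxima cannot claim the same stick.\<close>
  have unique: "C = D" if CD: "C \<in> local_maxima v K" "D \<in> local_maxima v K" and S: "S \<in> steep v"
    and x: "x \<in> S \<inter> C" "\<forall>z\<in>S. v \<bullet> z \<le> v \<bullet> x" and y: "y \<in> S \<inter> D" "\<forall>z\<in>S. v \<bullet> z \<le> v \<bullet> y" for C D S x y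
  proof -
    have "v \<bullet> x = v \<bullet> y" using x y by (meson IntD1 antisym)
    then have xy: "x = y" using steep_inj[OF S] x y by blast
    obtain c d where cd: "C \<in> components {x \<in> K. v \<bullet> x = c}" "D \<in> components {x \<in> K. v \<bullet> x = d}"
      using CD unfolding local_maxima_def by blast
    have "v \<bullet> x = c" "v \<bullet> x = d"
      using in_components_subset[OF cd(1)] in_components_subset[OF cd(2)] x y xy by auto
    then show ?thesis using components_eq[of C _ D] cd x y xy by blast
  qed
  let ?h = "\<lambda>(C, b). if b then f C else g C"
  have "inj_on ?h (local_maxima v K \<times> (UNIV :: bool set))"
    by (intro inj_onI) (auto split: if_splits dest: fg, (metis fg unique)+)
  moreover have "?h ` (local_maxima v K \<times> (UNIV :: bool set)) \<subseteq> steep v"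
    using fg by auto
  ultimately have "card (local_maxima v K \<times> (UNIV :: bool set)) \<le> card (steep v)"
    using finite_steep by (rule card_inj_on_le)
  then show ?thesis by (simp add: card_cartesian_product)
qed

text \<open>If all edges at the end \<open>u\<close> of a stick were collinear with it, the two edges at the vertex
  \<open>u\<close> would overlap.\<close>

lemma stick_end_turns:
  assumes S: "closed_segment u w \<in> sticks K"
  obtains k where "u \<in> edge k" "\<not> collinear (closed_segment u w \<union> edge k)"
proof (rule ccontr)
  let ?S = "closed_segment u w"
  assume "\<not> thesis"
  then have col: "collinear (?S \<union> edge k)" if "u \<in> edge k" for k
    using that \<open>\<And>k. u \<in> edge k \<Longrightarrow> \<not> collinear (?S \<union> edge k) \<Longrightarrow> thesis\<close> by blast
  have sub: "edge k \<subseteq> ?S" if "u \<in> edge k" for k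
    using stick_absorbs[OF S, of "p k" "p (Suc k)"] col[OF that] edge_subset_K[of k] that
    by (auto simp: edge_def)
  have SK: "?S \<subseteq> K" using S by (metis sticks_segment)
  then obtain k where k: "k < n" "u \<in> edge k" using in_K_E by (metis ends_in_segment(1) subsetD)
  \<comment> \<open>An end of a segment is an extreme point, hence not interior to an edge contained
    in the segment.\<close>
  have "u = p k \<or> u = p (Suc k)"
  proof (rule ccontr)
    assume "\<not> ?thesis"
    then have "u \<in> open_segment (p k) (p (Suc k))" using k by (simp add: edge_def open_segment_def)
    moreover have "p k \<in> ?S" "p (Suc k) \<in> ?S" using sub[OF k(2)] p_in_edge by blast+
    ultimately show False
      using extreme_point_of_segment[of u u w] unfolding extreme_point_of_def by blast
  qed
  \<comment> \<open>Adding \<open>n\<close> to the index provides a predecessor even for the vertex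
    with index 0.\<close>
  then obtain a where a: "u = p (Suc a)"
    by (metis p_add_n add_Suc_right le_add_diff_inverse2 n_ge_3 numeral_3_eq_3 Suc_le_D)
  have e: "edge a \<subseteq> ?S" "edge (Suc a) \<subseteq> ?S"
    using sub p_in_edge a by auto
  have uw: "u \<noteq> w" using S by (metis sticks_segment closed_segment_idem closed_segment_eq doubleton_eq_iff)
  \<comment> \<open>In the direction of the stick itself, \<open>u\<close> is its strictly highest
    point, so both edges at \<open>u\<close> descend.\<close>
  define v where "v = u - w"
  have below: "v \<bullet> z < v \<bullet> u" if z: "z \<in> ?S" "z \<noteq> u" for z
  proof -
    obtain t where t: "0 \<le> t" "z = (1 - t) *\<^sub>R u + t *\<^sub>R w" using z by (auto simp: in_segment)
    have "t > 0" using t z by (cases "t = 0") auto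
    moreover have "u - z = t *\<^sub>R v" using t by (simp add: v_def algebra_simps)
    moreover have "v \<bullet> v > 0" using uw by (simp add: v_def)
    ultimately have "v \<bullet> (u - z) > 0" by simp
    then show ?thesis by (simp add: inner_diff_right)
  qed
  show False
  proof (rule adjacent_edges_not_nested[OF refl e(2) e(1), of v])
    show "v \<bullet> p (Suc (Suc a)) < v \<bullet> p (Suc a)"
      using below[of "p (Suc (Suc a))"] subsetD[OF e(2) p_in_edge(2)] p_Suc_neq[of "Suc a"] a by simp
    show "v \<bullet> p a < v \<bullet> p (Suc a)"
      using below[of "p a"] subsetD[OF e(1) p_in_edge(1)] p_Suc_neq[of a] a by simp
  qed simp
qed

lemma not_collinear_K: "\<not> collinear K"
proof
  assume K: "collinear K"
  obtain S where S: "S \<in> sticks K" by (metis edge_in_stick)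
  then obtain u w where uw: "S = closed_segment u w" "S \<subseteq> K" by (metis sticks_segment)
  then obtain k where "\<not> collinear (closed_segment u w \<union> edge k)"
    using stick_end_turns S by metis
  then show False using K uw edge_subset_K[of k] by (metis Un_least collinear_subset)
qed

text \<open>The edges that miss \<open>x\<close> form a closed set, so close to \<open>x\<close> the
  segment can only run in edges through \<open>x\<close>.\<close>

lemma segment_starts_in_edge:
  assumes xy: "closed_segment x y \<subseteq> K" "x \<noteq> y"
  obtains k z where "k < n" "x \<in> edge k" "z \<in> edge k" "z \<in> closed_segment x y" "z \<noteq> x"
proof -
  define V where "V = - (\<Union>k\<in>{k. k < n \<and> x \<notin> edge k}. edge k)"
  have "closed (\<Union>k\<in>{k. k < n \<and> x \<notin> edge k}. edge k)"
    by (intro closed_UN) (auto simp: edge_def)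
  then have "open V" unfolding V_def by (rule open_Compl)
  moreover have "x \<in> V" by (auto simp: V_def)
  ultimately obtain e where e: "e > 0" "ball x e \<subseteq> V" using openE by metis
  define t where "t = min 1 (e / (2 * dist x y))"
  have t: "0 < t" "t \<le> 1" "t * dist x y < e"
    using e \<open>x \<noteq> y\<close> by (auto simp: t_def min_def field_simps)
  define z where "z = x + t *\<^sub>R (y - x)"
  have z: "z \<in> closed_segment x y"
    using t by (auto simp: z_def in_segment algebra_simps intro!: exI[of _ t])
  have "dist x z = t * dist x y"
    using t by (simp add: z_def dist_norm norm_minus_commute)
  then have "z \<in> V" using t e by auto
  obtain k where k: "k < n" "z \<in> edge k" using z xy in_K_E by blast
  have "x \<in> edge k" using \<open>z \<in> V\<close> k by (auto simp: V_def)
  moreover have "z \<noteq> x" using t xy by (simp add: z_def)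
  ultimately show ?thesis using that k z by blast
qed

text \<open>Any component of the highest level will do, with \<open>U = UNIV\<close>. Applied to the
  opposite direction, it gives a component of the lowest level.\<close>

lemma local_maximum_exists:
  obtains C where "C \<in> local_maxima v K" "\<And>x y. x \<in> C \<Longrightarrow> y \<in> K \<Longrightarrow> v \<bullet> y \<le> v \<bullet> x"
proof -
  have "continuous_on K (\<lambda>x. v \<bullet> x)" by (intro continuous_intros)
  then obtain x where x: "x \<in> K" "\<And>y. y \<in> K \<Longrightarrow> v \<bullet> y \<le> v \<bullet> x"
    using continuous_attains_sup[OF compact_K] p_in_K by (metis empty_iff)
  define C where "C = connected_component_set {y \<in> K. v \<bullet> y = v \<bullet> x} x"
  have C: "C \<in> components {y \<in> K. v \<bullet> y = v \<bullet> x}"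
    unfolding C_def using x by (intro componentsI) auto
  then have "C \<in> local_maxima v K"
    unfolding local_maxima_def using x by (intro CollectI exI[of _ "v \<bullet> x"] conjI exI[of _ UNIV]) auto
  moreover have "v \<bullet> y \<le> v \<bullet> z" if "z \<in> C" "y \<in> K" for y z
    using in_components_subset[OF C] that x by auto
  ultimately show ?thesis using that by blast
qed

text \<open>The only nonempty level set is all of \<open>K\<close>, which is connected. For the
  normal of a plane this bounds the bridge index by 1.\<close>

lemma card_local_maxima_flat:
  assumes "\<And>x. x \<in> K \<Longrightarrow> v \<bullet> x = c"
  shows "card (local_maxima v K) \<le> 1"
proof -
  have "C = K" if C: "C \<in> local_maxima v K" for C
  proof -
    obtain d where d: "C \<in> components {x \<in> K. v \<bullet> x = d}"
      using C unfolding local_maxima_def by blast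
    then obtain x where "x \<in> K" "v \<bullet> x = d"
      using in_components_nonempty in_components_subset by blast
    then have "{x \<in> K. v \<bullet> x = d} = K" using assms by auto
    then show ?thesis using d K_connected by (metis components_eq_sing_iff singletonD components_empty empty_iff)
  qed
  then have "local_maxima v K \<subseteq> {K}" by blast
  then have "card (local_maxima v K) \<le> card {K}" by (rule card_mono[rotated]) simp
  then show ?thesis by simp
qed

end

subsection \<open>Lattice polygons\<close>

lemma closed_segment_component:
  fixes x y z :: "real^'n"
  assumes "z \<in> closed_segment x y"
  shows "z $ k \<in> closed_segment (x $ k) (y $ k)"
  using assms by (auto simp: in_segment)

lemma three_axes: "(i :: 3) \<noteq> j \<Longrightarrow> i \<noteq> k \<Longrightarrow> j \<noteq> k \<Longrightarrow> l = i \<or> l = j \<or> l = k"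
  using exhaust_3[of i] exhaust_3[of j] exhaust_3[of k] exhaust_3[of l] by auto

lemma other_axes:
  obtains j k where "(i :: 3) \<noteq> j" "i \<noteq> k" "j \<noteq> k"
proof -
  have "(1::3) \<noteq> 2" "(1::3) \<noteq> 3" "(2::3) \<noteq> 3" by simp_all
  then show ?thesis using that exhaust_3[of i] by metis
qed

lemma collinear_if_two_components_const:
  fixes A :: "(real^3) set"
  assumes "i \<noteq> k" "\<And>x. x \<in> A \<Longrightarrow> x $ i = c" "\<And>x. x \<in> A \<Longrightarrow> x $ k = d"
  shows "collinear A"
proof -
  obtain j where j: "i \<noteq> j" "j \<noteq> k"
    using other_axes[of i] by metis
  have "x - y = (x $ j - y $ j) *\<^sub>R axis j 1" if "x \<in> A" "y \<in> A" for x y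
  proof -
    have "x $ i = y $ i" "x $ k = y $ k" using assms(2,3) that by auto
    then have "x $ l = y $ l" if "l \<noteq> j" for l
      using three_axes[of i j k l] assms(1) j that by auto
    then show ?thesis by (auto simp: vec_eq_iff axis_def)
  qed
  then show ?thesis unfolding collinear_def by blast
qed

lemma axis_parallel_segment:
  fixes x y z :: "real^3"
  assumes ijk: "i \<noteq> j" "i \<noteq> k" "j \<noteq> k"
    and i: "x $ i = z $ i" "y $ i = z $ i" and j: "x $ j = z $ j" "y $ j = z $ j"
    and k: "z $ k \<in> closed_segment (x $ k) (y $ k)"
  shows "z \<in> closed_segment x y"
proof -
  obtain t where t: "0 \<le> t" "t \<le> 1" "z $ k = (1 - t) * x $ k + t * y $ k"
    using k by (auto simp: in_segment)
  have "z $ l = ((1 - t) *\<^sub>R x + t *\<^sub>R y) $ l" for l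
    using three_axes[OF ijk, of l] i j t by (auto simp: algebra_simps)
  then have "z = (1 - t) *\<^sub>R x + t *\<^sub>R y" by (simp add: vec_eq_iff)
  then show ?thesis using t by (auto simp: in_segment)
qed

lemma Ints_add_fraction:
  fixes a s :: real
  assumes "a \<in> \<int>" "s \<noteq> 0" "\<bar>s\<bar> < 1"
  shows "a + s \<notin> \<int>"
proof
  assume "a + s \<in> \<int>"
  then have "s \<in> \<int>" using assms(1) by (metis Ints_diff add_diff_cancel_left')
  then show False using assms Ints_nonzero_abs_ge1[of s] by linarith
qed

locale lattice_polygon = simple_polygon +
  assumes vertices: "\<And>v i. v \<in> set vs \<Longrightarrow> v $ i \<in> \<int>"
    and in_lattice: "polygon_image vs \<subseteq> cubic_lattice"
begin

lemma p_Ints: "p k $ i \<in> \<int>"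
proof (rule vertices)
  show "p k \<in> set vs"
    using n_ge_3 unfolding p_def n_def by (intro nth_mem mod_less_divisor) linarith
qed

text \<open>A point of the lattice has at most one non-integral coordinate. If an edge changed two
  coordinates, a short step from its integral vertex would make both non-integral.\<close>

lemma edge_axis_parallel:
  obtains i where "\<And>j. j \<noteq> i \<Longrightarrow> p k $ j = p (Suc k) $ j"
proof (rule ccontr)
  assume no: "\<not> thesis"
  have "\<exists>j. j \<noteq> i \<and> p k $ j \<noteq> p (Suc k) $ j" for i
    using no that by metis
  then obtain j l where jl: "j \<noteq> l" "p k $ j \<noteq> p (Suc k) $ j" "p k $ l \<noteq> p (Suc k) $ l"
    by metis
  define d where "d = p (Suc k) - p k"
  have d: "d $ j \<noteq> 0" "d $ l \<noteq> 0" using jl by (auto simp: d_def)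
  \<comment> \<open>Small enough that neither of the two coordinates changes by 1 or more, and at
    most 1, so that \<open>q\<close> stays on the edge.\<close>
  define t where "t = 1 / (1 + \<bar>d $ j\<bar> + \<bar>d $ l\<bar>)"
  have t: "0 < t" "t \<le> 1" "t * \<bar>d $ j\<bar> < 1" "t * \<bar>d $ l\<bar> < 1"
    by (auto simp: t_def field_simps add_pos_nonneg)
  define q where "q = p k + t *\<^sub>R d"
  have "q \<in> edge k"
    using t by (auto simp: q_def d_def edge_def in_segment algebra_simps intro!: exI[of _ t])
  then have "q \<in> cubic_lattice"
    using edge_subset_K[of k] in_lattice by (auto simp: K_def)
  then have "q $ j \<in> \<int> \<or> q $ l \<in> \<int>"
    using jl(1) exhaust_3[of j] exhaust_3[of l] by (auto simp: cubic_lattice_def)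
  moreover have "q $ j \<notin> \<int>" "q $ l \<notin> \<int>"
    using t d Ints_add_fraction[OF p_Ints, of "t * d $ j" k j] Ints_add_fraction[OF p_Ints, of "t * d $ l" k l]
    by (auto simp: q_def abs_mult)
  ultimately show False by blast
qed

abbreviation axis_sticks :: "3 \<Rightarrow> (real^3) set set" where
  "axis_sticks i \<equiv> steep (axis i 1)"

lemma axis_sticksI:
  "S \<in> sticks K \<Longrightarrow> x \<in> S \<Longrightarrow> y \<in> S \<Longrightarrow> x $ i \<noteq> y $ i \<Longrightarrow> S \<in> axis_sticks i"
  unfolding steep_def by (auto simp: inner_axis')

text \<open>A stick contains an edge, which is parallel to one axis. For any other axis the ends of
  this edge have equal height, which is impossible in a stick steep for that axis.\<close>

lemma axis_sticks_disjoint: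
  assumes "i \<noteq> j"
  shows "axis_sticks i \<inter> axis_sticks j = {}"
proof (rule ccontr)
  assume "\<not> ?thesis"
  then obtain S where S: "S \<in> axis_sticks i" "S \<in> axis_sticks j" by blast
  obtain k where k: "edge k \<subseteq> S"
    using S(1) stick_contains_edge unfolding steep_def by blast
  obtain i0 where i0: "\<And>j. j \<noteq> i0 \<Longrightarrow> p k $ j = p (Suc k) $ j"
    using edge_axis_parallel by blast
  obtain l where l: "l \<noteq> i0" "S \<in> axis_sticks l" using S assms by metis
  have "p k = p (Suc k)"
    by (rule steep_inj[OF l(2)]) (use k p_in_edge[of k] i0[OF l(1)] in \<open>auto simp: inner_axis'\<close>)
  then show False using p_Suc_neq[of k] by simp
qed

lemma axis_sticks_component_const:
  assumes "S \<in> axis_sticks i" "x \<in> S" "y \<in> S" "j \<noteq> i"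
  shows "x $ j = y $ j"
proof (rule ccontr)
  assume "x $ j \<noteq> y $ j"
  moreover have "S \<in> sticks K" using assms(1) unfolding steep_def by blast
  ultimately have "S \<in> axis_sticks j"
    using assms by (intro axis_sticksI[of S x y])
  then show False using assms axis_sticks_disjoint by blast
qed

lemma card_sticks_ge:
  assumes ijk: "i \<noteq> j" "i \<noteq> k" "j \<noteq> k"
  shows "card (axis_sticks i) + card (axis_sticks j) + card (axis_sticks k) \<le> card (sticks K)"
proof -
  have "card (axis_sticks i \<union> axis_sticks j \<union> axis_sticks k) =
      card (axis_sticks i) + card (axis_sticks j) + card (axis_sticks k)"
    using axis_sticks_disjoint ijk finite_steep
    by (subst card_Un_disjoint; (subst card_Un_disjoint)?) (auto simp: Int_Un_distrib2)
  moreover have "axis_sticks i \<union> axis_sticks j \<union> axis_sticks k \<subseteq> sticks K"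
    unfolding steep_def by blast
  ultimately show ?thesis using card_mono[OF finite_sticks] by metis
qed

end

section \<open>Lattice polygons in a coordinate plane\<close>

locale planar_lattice_polygon = lattice_polygon +
  fixes i j k :: 3 and c :: real
  assumes ijk: "i \<noteq> j" "i \<noteq> k" "j \<noteq> k"
    and planar: "\<And>x. x \<in> K \<Longrightarrow> x $ i = c"
begin

text \<open>A second constant coordinate would make \<open>K\<close> collinear. Both signs are
  stated because one gives the top and the other the bottom of \<open>K\<close>.\<close>

lemma nonflat: "\<exists>x\<in>K. axis k 1 \<bullet> x \<noteq> d" "\<exists>x\<in>K. - axis k 1 \<bullet> x \<noteq> d"
proof -
  have *: "\<exists>x\<in>K. x $ k \<noteq> d" for d
    using collinear_if_two_components_const[of i k K c d] ijk planar not_collinear_K by blast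
  show "\<exists>x\<in>K. axis k 1 \<bullet> x \<noteq> d" using *[of d] by (simp add: inner_axis')
  show "\<exists>x\<in>K. - axis k 1 \<bullet> x \<noteq> d" using *[of "- d"] by (auto simp: inner_axis')
qed

lemma steep_uminus: "steep (- v) = steep v"
  unfolding steep_def by simp

lemma two_axis_sticks: "2 \<le> card (axis_sticks k)"
proof -
  obtain C where C: "C \<in> local_maxima (axis k 1) K" by (rule local_maximum_exists)
  obtain S T where "S \<in> axis_sticks k" "T \<in> axis_sticks k" "S \<noteq> T"
    using local_maximum_two_sticks[OF C nonflat(1)] by metis
  then have "card {S, T} = 2" "{S, T} \<subseteq> axis_sticks k" by auto
  then show ?thesis using card_mono[OF finite_steep] by metis
qed

text \<open>The other two coordinates are constant on \<open>C\<close>, and coordinate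
  \<open>j\<close> maps the connected set \<open>C\<close> onto an interval. This yields the
  horizontal sides of the rectangle.\<close>

lemma local_maximum_level_segment:
  assumes C: "C \<in> local_maxima v K" and v: "v = axis k 1 \<or> v = - axis k 1"
    and xy: "x \<in> C" "y \<in> C" and z: "z $ i = c" "z $ j \<in> closed_segment (x $ j) (y $ j)" "z $ k = x $ k"
  shows "z \<in> K"
proof -
  obtain h where h: "C \<in> components {x \<in> K. v \<bullet> x = h}"
    using C unfolding local_maxima_def by blast
  have "connected ((\<lambda>x. x $ j) ` C)"
    using in_components_connected[OF h] by (intro connected_continuous_image continuous_intros)
  then have "convex ((\<lambda>x. x $ j) ` C)" by (simp flip: is_interval_connected_1 is_interval_convex_1)
  then have "closed_segment (x $ j) (y $ j) \<subseteq> (\<lambda>x. x $ j) ` C"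
    using xy by (intro closed_segment_subset) auto
  then obtain z' where z': "z' \<in> C" "z' $ j = z $ j" using z by auto
  have "z' \<in> K" "v \<bullet> z' = h" "v \<bullet> x = h"
    using in_components_subset[OF h] z' xy by auto
  moreover from this have "z' $ k = x $ k" using v by (auto simp: inner_axis')
  ultimately have "z' $ l = z $ l" for l
    using three_axes[OF ijk, of l] planar[of z'] z z' by auto
  then show ?thesis using \<open>z' \<in> K\<close> by (metis vec_eq_iff)
qed

text \<open>Both vertical sticks reach from the minimal to the maximal height, which gives the rectangle. A
  stick at an intermediate height would end on them, in a point from which \<open>K\<close> starts in three
  directions.\<close>

lemma two_sticks_imp_rectangle:
  assumes two: "card (axis_sticks k) = 2"
  shows "\<exists>a b m M. a < b \<and> m < M \<and> K = rectangle i j k c a b m M"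
proof -
  obtain C where C: "C \<in> local_maxima (axis k 1) K"
    and Cmax: "\<And>x y. x \<in> C \<Longrightarrow> y \<in> K \<Longrightarrow> y $ k \<le> x $ k"
    using local_maximum_exists[of "axis k 1"] by (auto simp: inner_axis')
  obtain D where D: "D \<in> local_maxima (- axis k 1) K"
    and Dmin: "\<And>x y. x \<in> D \<Longrightarrow> y \<in> K \<Longrightarrow> x $ k \<le> y $ k"
    using local_maximum_exists[of "- axis k 1"] by (auto simp: inner_axis')
  obtain S T x x' where ST: "S \<in> axis_sticks k" "T \<in> axis_sticks k" "S \<noteq> T"
    and x: "x \<in> S \<inter> C" "x' \<in> T \<inter> C"
    using local_maximum_two_sticks[OF C nonflat(1)] by metis
  obtain S' T' where ST': "S' \<in> axis_sticks k" "T' \<in> axis_sticks k" "S' \<noteq> T'"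
    and SD: "S' \<inter> D \<noteq> {}" "T' \<inter> D \<noteq> {}"
    using local_maximum_two_sticks[OF D nonflat(2)] unfolding steep_uminus by (metis empty_iff)
  \<comment> \<open>There are only two vertical sticks, so the two that start at the top
    \<open>C\<close> are also the two that start at the bottom \<open>D\<close>.\<close>
  have "card {S, T} = card (axis_sticks k)" using ST two by simp
  then have steepST: "axis_sticks k = {S, T}"
    using ST card_subset_eq[OF finite_steep, of "{S, T}" "axis k 1"] by auto
  then have "{S', T'} = {S, T}" using ST' by auto
  then obtain y y' where y: "y \<in> S \<inter> D" "y' \<in> T \<inter> D"
    using SD by (metis doubleton_eq_iff ex_in_conv)
  have CK: "C \<subseteq> K" and DK: "D \<subseteq> K"
    using C D in_components_subset unfolding local_maxima_def by blast+
  have sub: "S \<subseteq> K" "T \<subseteq> K" using ST unfolding steep_def sticks_def line_segment_in_def by blast+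
  define m where "m = y $ k"
  define M where "M = x $ k"
  have xM: "x $ k = M" "x' $ k = M" and ym: "y $ k = m" "y' $ k = m"
    using Cmax[of x x'] Cmax[of x' x] Dmin[of y y'] Dmin[of y' y] x y
      subsetD[OF CK, of x] subsetD[OF CK, of x'] subsetD[OF DK, of y] subsetD[OF DK, of y']
    by (simp_all add: m_def M_def)
  have bounds: "m \<le> z $ k" "z $ k \<le> M" if "z \<in> K" for z
    using that Cmax Dmin x y by (auto simp: m_def M_def)
  have "m < M"
  proof (rule ccontr)
    assume "\<not> m < M"
    then have "z $ k = m" if "z \<in> K" for z using bounds[OF that] by linarith
    then show False using nonflat(1)[of m] by (auto simp: inner_axis')
  qed
  define column where "column a = {z :: real^3. z $ i = c \<and> z $ j = a \<and> m \<le> z $ k \<and> z $ k \<le> M}" for a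
  have column: "R = column (z $ j)" if R: "R \<in> axis_sticks k"
    and z: "z \<in> R" "z' \<in> R" "z $ k = M" "z' $ k = m" for R z z'
  proof
    obtain u w where uw: "R = closed_segment u w" "R \<subseteq> K"
      using R sticks_segment unfolding steep_def by blast
    show "R \<subseteq> column (z $ j)"
      using axis_sticks_component_const[OF R _ z(1), of _ j] ijk uw planar bounds
      by (auto simp: column_def)
    show "column (z $ j) \<subseteq> R"
    proof
      fix q assume q: "q \<in> column (z $ j)"
      have "z' $ j = z $ j" by (rule axis_sticks_component_const[OF R z(2,1)]) (use ijk in auto)
      then have "q \<in> closed_segment z' z"
        using q z uw planar by (intro axis_parallel_segment[OF ijk])
          (auto simp: column_def closed_segment_eq_real_ivl)
      moreover have "closed_segment z' z \<subseteq> R"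
        unfolding uw(1) using z uw by (intro closed_segment_subset) auto
      ultimately show "q \<in> R" by blast
    qed
  qed
  have S: "S = column (x $ j)" and T: "T = column (x' $ j)"
    using column[OF ST(1), of x y] column[OF ST(2), of x' y'] x y xM ym by auto
  define a where "a = min (x $ j) (x' $ j)"
  define b where "b = max (x $ j) (x' $ j)"
  have "x $ j \<noteq> x' $ j" using S T ST by auto
  then have ab: "a < b" "{a, b} = {x $ j, x' $ j}" "closed_segment (x $ j) (x' $ j) = {a..b}"
    by (auto simp: a_def b_def closed_segment_eq_real_ivl)
  then have columns: "axis_sticks k = {column a, column b}"
    using steepST S T by (metis doubleton_eq_iff)
  have columns_K: "column a \<subseteq> K" "column b \<subseteq> K"
    using columns steepST sub by (metis insertCI insertE singletonD)+
  have yj: "y $ j = x $ j" "y' $ j = x' $ j"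
    using S T x y by (auto simp: column_def)
  have "rectangle i j k c a b m M \<subseteq> K"
  proof
    fix z assume z: "z \<in> rectangle i j k c a b m M"
    show "z \<in> K"
    proof (cases "z \<in> column a \<union> column b")
      case True
      then show ?thesis using columns_K by blast
    next
      case False
      then have z': "z $ i = c" "z $ j \<in> {a..b}" "z $ k = m \<or> z $ k = M"
        using z by (auto simp: rectangle_def column_def)
      then show ?thesis
        using local_maximum_level_segment[OF C _ _ _ z'(1), of x x']
          local_maximum_level_segment[OF D _ _ _ z'(1), of y y'] x y xM ym yj ab(3) by auto
    qed
  qed
  moreover have "K \<subseteq> rectangle i j k c a b m M"
  proof
    fix z assume z: "z \<in> K"
    then obtain l where l: "z \<in> edge l" using in_K_E by blast
    obtain Q where Q: "Q \<in> sticks K" "edge l \<subseteq> Q" by (rule edge_in_stick)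
    show "z \<in> rectangle i j k c a b m M"
    proof (cases "Q \<in> axis_sticks k")
      case True
      then have "z \<in> column a \<union> column b" using columns l Q by blast
      then show ?thesis by (auto simp: column_def rectangle_def)
    next
      case False
      obtain u w where uw: "Q = closed_segment u w" "u \<noteq> w" "Q \<subseteq> K"
        using Q(1) by (rule sticks_segment)
      have Qk: "z $ k = u $ k" if "z \<in> Q" for z
        using axis_sticksI[OF Q(1), of z u k] False that uw(1) by auto
      have uwk: "w $ k = u $ k" using Qk[of w] uw by simp
      have uwK: "u \<in> K" "w \<in> K" using uw by auto
      \<comment> \<open>Some edge turns away from \<open>Q\<close> at its end \<open>e\<close>. Were
        the stick of that edge horizontal too, the edge and \<open>Q\<close> would share the height
        as well as coordinate \<open>i\<close> and be collinear. So this stick is vertical, and it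
        is one of the two columns.\<close>
      have end_in_column: "e \<in> column a \<union> column b" if Qe: "Q = closed_segment e f" for e f
      proof -
        have "closed_segment e f \<in> sticks K" using Q Qe by simp
        then obtain l where l: "e \<in> edge l" "\<not> collinear (Q \<union> edge l)"
          using stick_end_turns Qe by metis
        obtain P where P: "P \<in> sticks K" "edge l \<subseteq> P" by (rule edge_in_stick)
        have "P \<in> axis_sticks k"
        proof (rule ccontr)
          assume "P \<notin> axis_sticks k"
          then have "q $ k = e $ k" if "q \<in> edge l" for q
            using axis_sticksI[OF P(1) subsetD[OF P(2) that] subsetD[OF P(2) l(1)], of k] by blast
          moreover have "e $ k = u $ k" using Qk Qe by simp
          ultimately have "q $ k = u $ k" if "q \<in> Q \<union> edge l" for q
            using that Qk by auto
          moreover have "q $ i = c" if "q \<in> Q \<union> edge l" for q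
            using that planar uw edge_subset_K[of l] by blast
          ultimately show False
            using collinear_if_two_components_const[of i k "Q \<union> edge l"] ijk l by blast
        qed
        then show ?thesis using columns l P by blast
      qed
      have uc: "u \<in> column a \<union> column b" and wc: "w \<in> column a \<union> column b"
        using end_in_column[of u w] end_in_column[of w u] uw closed_segment_commute[of u w] by auto
      have "u $ j \<noteq> w $ j"
      proof
        assume "u $ j = w $ j"
        then have "u $ l = w $ l" for l
          using three_axes[OF ijk, of l] planar uwK uwk by auto
        then show False using uw by (simp add: vec_eq_iff)
      qed
      then have seg: "closed_segment (u $ j) (w $ j) = {a..b}"
        using uc wc ab(1) by (auto simp: column_def closed_segment_eq_real_ivl)
      have zQ: "z \<in> Q" using l Q by blast
      have zj: "z $ j \<in> {a..b}"
        using closed_segment_component[of z u w j] zQ uw seg by simp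
      have "u $ k \<in> {m, M}"
      proof (rule ccontr)
        assume "u $ k \<notin> {m, M}"
        then have uk: "m < u $ k" "u $ k < M" using bounds[OF uwK(1)] by auto
        \<comment> \<open>\<open>e\<close> is the point of the column through \<open>u\<close> at
          height \<open>h\<close>. The segment from \<open>u\<close> to \<open>e\<close> lies in
          that column, so some edge at \<open>u\<close> leaves towards \<open>h\<close>.\<close>
        have exit: "\<exists>l q. l < n \<and> u \<in> edge l \<and> q \<in> edge l \<and> q \<in> closed_segment u e \<and> q $ k \<noteq> u $ k"
          if h: "h \<in> {m, M}" and e: "e = (\<chi> l. if l = k then h else u $ l)" for e h
        proof -
          have "h \<noteq> u $ k" using h uk by auto
          then have "u \<noteq> e" using e by (auto simp: vec_eq_iff)
          have "closed_segment u e \<subseteq> column (u $ j)"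
          proof
            fix q assume q: "q \<in> closed_segment u e"
            have "q $ k \<in> closed_segment (u $ k) h" "q $ i = u $ i" "q $ j = u $ j"
              using closed_segment_component[OF q, of k] closed_segment_component[OF q, of i]
                closed_segment_component[OF q, of j] e ijk by auto
            then show "q \<in> column (u $ j)"
              using h uk planar[OF uwK(1)] by (auto simp: column_def closed_segment_eq_real_ivl split: if_splits)
          qed
          moreover have "u $ j = a \<or> u $ j = b" using uc by (auto simp: column_def)
          ultimately have "closed_segment u e \<subseteq> K" using columns_K by blast
          then obtain l q where lq: "l < n" "u \<in> edge l" "q \<in> edge l" "q \<in> closed_segment u e" "q \<noteq> u"
            using \<open>u \<noteq> e\<close> by (rule segment_starts_in_edge)
          have "q $ k \<noteq> u $ k"
          proof
            assume "q $ k = u $ k"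
            moreover have "q $ i = u $ i" "q $ j = u $ j"
              using closed_segment_component[OF lq(4), of i]
                closed_segment_component[OF lq(4), of j] e ijk by auto
            ultimately have "q $ l = u $ l" for l using three_axes[OF ijk, of l] by auto
            then show False using lq(5) by (simp add: vec_eq_iff)
          qed
          then show ?thesis using lq by blast
        qed
        define up where "up = (\<chi> l. if l = k then M else u $ l)"
        define down where "down = (\<chi> l. if l = k then m else u $ l)"
        obtain l1 q1 where 1: "l1 < n" "u \<in> edge l1" "q1 \<in> edge l1" "q1 \<in> closed_segment u up" "q1 $ k \<noteq> u $ k"
          using exit[OF _ up_def] by blast
        obtain l2 q2 where 2: "l2 < n" "u \<in> edge l2" "q2 \<in> edge l2" "q2 \<in> closed_segment u down" "q2 $ k \<noteq> u $ k"
          using exit[OF _ down_def] by blast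
        obtain l3 q3 where 3: "l3 < n" "u \<in> edge l3" "q3 \<in> edge l3" "q3 \<in> closed_segment u w" "q3 \<noteq> u"
          by (rule segment_starts_in_edge[of u w]) (use uw in auto)
        have q1: "q1 $ k > u $ k" and q2: "q2 $ k < u $ k"
          using closed_segment_component[OF 1(4), of k] 1(5) closed_segment_component[OF 2(4), of k] 2(5) uk
          by (auto simp: up_def down_def closed_segment_eq_real_ivl split: if_splits)
        have l3: "q $ k = u $ k" if "q \<in> edge l3" for q
          using segment_height_const[OF edge_def 3(2,3), of "axis k 1" q] 3 that Qk[of q3] uw(1)
          by (auto simp: inner_axis')
        \<comment> \<open>Edge \<open>l3\<close> is level, the other two are not. At most two edges
          meet in \<open>u\<close>, so \<open>l1 = l2\<close>; having \<open>u\<close> in common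
          with \<open>l3\<close>, this edge ends at \<open>u\<close>, although it reaches both above
          and below \<open>u\<close>.\<close>
        have ne: "l1 \<noteq> l3" "l2 \<noteq> l3" using l3 1 2 by auto
        then have "l1 = l2" using three_edges[OF 1(2) 2(2) 3(2)] 1 2 3 by auto
        have "u \<in> {p l1, p (Suc l1)}"
          using edge_Int[of l1 l3] ne 1 3 by auto
        then obtain e where "edge l1 = closed_segment u e"
          unfolding edge_def by (metis closed_segment_commute insert_iff singletonD)
        then have "q1 $ k \<in> closed_segment (u $ k) (e $ k)" "q2 $ k \<in> closed_segment (u $ k) (e $ k)"
          using 1 2 \<open>l1 = l2\<close> closed_segment_component by auto
        then show False using q1 q2 by (auto simp: closed_segment_eq_real_ivl split: if_splits)
      qed
      then show ?thesis
        using zj Qk[OF zQ] planar[OF z] by (auto simp: rectangle_def)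
    qed
  qed
  ultimately show ?thesis using ab \<open>m < M\<close> by blast
qed

lemma trivial_or_three_axis_sticks:
  "trivial_knot K \<or> 3 \<le> card (axis_sticks k)"
proof (cases "card (axis_sticks k) = 2")
  case True
  then obtain a b m M where "a < b" "m < M" "K = rectangle i j k c a b m M"
    using two_sticks_imp_rectangle by blast
  then show ?thesis using trivial_knot_rectangle[OF ijk, of a b m M c] by simp
next
  case False
  then show ?thesis using two_axis_sticks by linarith
qed

end

section \<open>Counting over the three axes\<close>

context lattice_polygon
begin

lemma six_times_bridge_le_card_sticks:
  assumes nontrivial: "\<not> trivial_knot K"
    and b: "\<And>v. v \<in> sphere 0 1 \<Longrightarrow> b \<le> card (local_maxima v K)"
  shows "6 * b \<le> card (sticks K)"
proof (cases "\<exists>i c. \<forall>x\<in>K. x $ i = c")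
  case True
  then obtain i c where planar: "\<And>x. x \<in> K \<Longrightarrow> x $ i = c" by blast
  obtain j k where ijk: "i \<noteq> j" "i \<noteq> k" "j \<noteq> k"
    by (rule other_axes)
  \<comment> \<open>The planar locale treats its last axis as vertical; exchanging \<open>j\<close>
    and \<open>k\<close> gives the bound of three sticks for both directions of the plane.\<close>
  interpret jk: planar_lattice_polygon vs i j k c
    by unfold_locales (erule planar | rule ijk ijk(3)[symmetric])+
  interpret kj: planar_lattice_polygon vs i k j c
    by unfold_locales (erule planar | rule ijk ijk(3)[symmetric])+
  \<comment> \<open>Here the normal of the plane is the direction in which the local maxima are
    counted.\<close>
  have "b \<le> card (local_maxima (axis i 1) K)" by (rule b) simp
  also have "\<dots> \<le> 1"
    by (rule card_local_maxima_flat[of _ c]) (simp add: inner_axis' planar)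
  finally show ?thesis
    using jk.trivial_or_three_axis_sticks kj.trivial_or_three_axis_sticks nontrivial
      card_sticks_ge[OF ijk] by linarith
next
  case False
  have "2 * b \<le> card (axis_sticks i)" for i
  proof -
    have "2 * card (local_maxima (axis i 1) K) \<le> card (axis_sticks i)"
      by (rule card_steep_ge) (use False in \<open>auto simp: inner_axis'\<close>)
    then show ?thesis using b[of "axis i 1"] by simp
  qed
  from this[of 1] this[of 2] this[of 3] show ?thesis
    using card_sticks_ge[of 1 2 3] by simp
qed

end

theorem lemma2p1:
  fixes K :: "(real^3) set"
  assumes "polygonal_knot K"
    and "\<not> trivial_knot K"
  shows "cubic_lattice_stick_index (knot_type K) \<ge> 6 * enat (bridge_index (knot_type K))"
proof -
  have "6 * enat (bridge_index (knot_type K)) \<le> enat (card (sticks L))"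
    if L: "L \<in> knot_type K" "lattice_conformation L" for L
  proof -
    obtain vs where vs: "simple_closed_polygon vs" "L = polygon_image vs"
      "\<forall>v\<in>set vs. \<forall>i. v $ i \<in> \<int>" "L \<subseteq> cubic_lattice"
      using L(2) unfolding lattice_conformation_def by blast
    interpret lattice_polygon vs
      using vs by unfold_locales auto
    have L_eq: "simple_polygon.K vs = L"
      by (simp add: vs K_def)
    \<comment> \<open>An isotopy from \<open>L\<close> to the unknot would extend the one from
      \<open>K\<close> to \<open>L\<close> and make \<open>K\<close> trivial.\<close>
    have "\<not> trivial_knot L"
      using assms(2) L(1) ambient_isotopic_trans unfolding trivial_knot_def knot_type_def by blast
    moreover have "bridge_index (knot_type K) \<le> card (local_maxima v L)" if "v \<in> sphere 0 1" for v
    proof -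
      have "bridge_index (knot_type K) \<le> (INF v\<in>sphere 0 1. card (local_maxima v L))"
        unfolding bridge_index_def using L(1) by (intro cINF_lower) auto
      also have "\<dots> \<le> card (local_maxima v L)"
        using that by (intro cINF_lower) auto
      finally show ?thesis .
    qed
    ultimately have "6 * bridge_index (knot_type K) \<le> card (sticks L)"
      using six_times_bridge_le_card_sticks L_eq by metis
    then show ?thesis by (simp add: numeral_eq_enat)
  qed
  then show ?thesis
    unfolding cubic_lattice_stick_index_def by (intro INF_greatest) auto
qed

end
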